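(* Let $(M,g)$ be a Riemannian manifold and, for $x\in M$, let $\exp_x^{(M,g)}$ be the exponential map at $x$. Let $f_{21}=[f_2,f_1]$ and $f_{121}=[f_1,f_{21}]$. Then, for every $(x,V,R)\in TM\oplus TM$, $$\pi^M\circ e^{tf_{21}}(x,V,R)=\exp_x^{(M,g)}(tV),$$ $$\pi^M\circ e^{tf_{121}}(x,V,R)=\exp_x^{(M,g)}(tR),$$ for every $t\in\mathbb R$ such that the flow of the respective field is defined.
   Context: $f_1,f_2$ are the global vector fields on $TM\oplus TM$ whose integral curves $(x,V,R)(t)$ satisfy $$f_1:\ \dot x=V,\ D_tR=-V,\ D_tV=R;\qquad f_2:\ \dot x=0,\ \dot R=R,\ \dot V=V,$$ where $D_t$ is the Levi-Civita covariant derivative along $x(t)$. $[X,Y]=XY-YX$ is the Lie bracket of vector fields, $e^{tX}$ is the flow of $X$ at time $t$, and $\pi^M:TM\oplus TM\to M$, $(x,V,R)\mapsto x$, is the projection. The paper assumes throughout $\dim M>1$. *)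

theory Defs
  imports "HOL-Analysis.Analysis"
begin

section \<open>Smooth functions between Euclidean spaces\<close>

text \<open>Intended for open sets: for open \<open>S\<close> in a Euclidean space this is the usual class \<open>C^k\<close>
  (all iterated directional derivatives up to order \<open>k\<close> exist and are continuous).\<close>

primrec Ck_on :: "nat \<Rightarrow> ('a::real_normed_vector \<Rightarrow> 'b::real_normed_vector) \<Rightarrow> 'a set \<Rightarrow> bool" where
  "Ck_on 0 f S \<longleftrightarrow> continuous_on S f"
| "Ck_on (Suc k) f S \<longleftrightarrow>
     (\<forall>x\<in>S. f differentiable (at x)) \<and> (\<forall>v. Ck_on k (\<lambda>x. frechet_derivative f (at x) v) S)"

definition smooth_on :: "'a set \<Rightarrow> ('a::real_normed_vector \<Rightarrow> 'b::real_normed_vector) \<Rightarrow> bool" where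
  "smooth_on S f \<longleftrightarrow> (\<forall>k. Ck_on k f S)"


section \<open>Smooth manifolds\<close>

text \<open>A chart is a domain together with a map into the model space; the values of the map outside
  the domain are irrelevant.  The underlying set of the manifold is the union of the chart domains,
  and its topology is the one induced by the atlas.\<close>

type_synonym ('a, 'e) chart = "'a set \<times> ('a \<Rightarrow> 'e)"

definition cdom :: "('a, 'e) chart \<Rightarrow> 'a set" where
  "cdom c = fst c"

definition cmap :: "('a, 'e) chart \<Rightarrow> 'a \<Rightarrow> 'e" where
  "cmap c = snd c"

definition cimg :: "('a, 'e) chart \<Rightarrow> 'e set" where
  "cimg c = cmap c ` cdom c"

definition cinv :: "('a, 'e) chart \<Rightarrow> 'e \<Rightarrow> 'a" where
  "cinv c = inv_into (cdom c) (cmap c)"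

definition transition :: "('a, 'e) chart \<Rightarrow> ('a, 'e) chart \<Rightarrow> 'e \<Rightarrow> 'e" where
  "transition c c' = cmap c' \<circ> cinv c"

definition carrier :: "('a, 'e) chart set \<Rightarrow> 'a set" where
  "carrier A = (\<Union>c\<in>A. cdom c)"

definition smooth_atlas :: "('a, 'e::euclidean_space) chart set \<Rightarrow> bool" where
  "smooth_atlas A \<longleftrightarrow>
     (\<forall>c\<in>A. inj_on (cmap c) (cdom c) \<and> open (cimg c)) \<and>
     (\<forall>c\<in>A. \<forall>c'\<in>A. open (cmap c ` (cdom c \<inter> cdom c')) \<and>
        smooth_on (cmap c ` (cdom c \<inter> cdom c')) (transition c c'))"

definition mfd_topology :: "('a, 'e::euclidean_space) chart set \<Rightarrow> 'a topology" where
  "mfd_topology A = topology (\<lambda>W. W \<subseteq> carrier A \<and> (\<forall>c\<in>A. open (cmap c ` (W \<inter> cdom c))))"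

lemma openin_mfd_topology:
  assumes "\<forall>c\<in>A. inj_on (cmap c) (cdom c)"
  shows "openin (mfd_topology A) W \<longleftrightarrow> W \<subseteq> carrier A \<and> (\<forall>c\<in>A. open (cmap c ` (W \<inter> cdom c)))"
proof -
  have "istopology (\<lambda>W. W \<subseteq> carrier A \<and> (\<forall>c\<in>A. open (cmap c ` (W \<inter> cdom c))))"
    unfolding istopology_def
  proof (intro conjI allI impI; (elim conjE)?)
    fix S T assume S: "S \<subseteq> carrier A" "\<forall>c\<in>A. open (cmap c ` (S \<inter> cdom c))"
      and T: "T \<subseteq> carrier A" "\<forall>c\<in>A. open (cmap c ` (T \<inter> cdom c))"
    show "S \<inter> T \<subseteq> carrier A" using S by blast
    show "\<forall>c\<in>A. open (cmap c ` (S \<inter> T \<inter> cdom c))"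
    proof
      fix c assume c: "c \<in> A"
      have "cmap c ` (S \<inter> T \<inter> cdom c) = cmap c ` (S \<inter> cdom c) \<inter> cmap c ` (T \<inter> cdom c)"
        using assms c by (auto simp: inj_on_def)
      then show "open (cmap c ` (S \<inter> T \<inter> cdom c))" using S T c by auto
    qed
  next
    fix K assume K: "\<forall>W\<in>K. W \<subseteq> carrier A \<and> (\<forall>c\<in>A. open (cmap c ` (W \<inter> cdom c)))"
    then show "\<Union>K \<subseteq> carrier A" by blast
    show "\<forall>c\<in>A. open (cmap c ` (\<Union>K \<inter> cdom c))"
    proof
      fix c assume c: "c \<in> A"
      have "cmap c ` (\<Union>K \<inter> cdom c) = (\<Union>W\<in>K. cmap c ` (W \<inter> cdom c))" by blast
      then show "open (cmap c ` (\<Union>K \<inter> cdom c))" using K c by auto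
    qed
  qed
  then show ?thesis unfolding mfd_topology_def by (simp add: topology_inverse')
qed

definition smooth_manifold :: "('a, 'e::euclidean_space) chart set \<Rightarrow> bool" where
  "smooth_manifold A \<longleftrightarrow>
     smooth_atlas A \<and> Hausdorff_space (mfd_topology A) \<and> second_countable (mfd_topology A)"

definition smooth_fun_on :: "('a, 'e::euclidean_space) chart set \<Rightarrow> 'a set \<Rightarrow> ('a \<Rightarrow> real) \<Rightarrow> bool" where
  "smooth_fun_on A U f \<longleftrightarrow> (\<forall>c\<in>A. smooth_on (cmap c ` (U \<inter> cdom c)) (f \<circ> cinv c))"


section \<open>Tangent vectors and vector fields\<close>

text \<open>A tangent vector at \<open>p\<close> is the family of its coordinate representations in the charts around
  \<open>p\<close>, related by the derivatives of the transition maps; it is extended by \<open>0\<close> to all other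
  charts, so that the vector space operations are pointwise and equality is equality of vectors.\<close>

type_synonym ('a, 'e) tangent = "('a, 'e) chart \<Rightarrow> 'e"

definition tangent_space ::
    "('a, 'e::euclidean_space) chart set \<Rightarrow> 'a \<Rightarrow> ('a, 'e) tangent set" where
  "tangent_space A p = {v.
     (\<forall>c. \<not> (c \<in> A \<and> p \<in> cdom c) \<longrightarrow> v c = 0) \<and>
     (\<forall>c\<in>A. \<forall>c'\<in>A. p \<in> cdom c \<inter> cdom c' \<longrightarrow>
        v c' = frechet_derivative (transition c c') (at (cmap c p)) (v c))}"

definition tzero :: "('a, 'e::euclidean_space) tangent" where
  "tzero = (\<lambda>c. 0)"

definition tadd ::
    "('a, 'e::euclidean_space) tangent \<Rightarrow> ('a, 'e) tangent \<Rightarrow> ('a, 'e) tangent" where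
  "tadd v w = (\<lambda>c. v c + w c)"

definition tscale :: "real \<Rightarrow> ('a, 'e::euclidean_space) tangent \<Rightarrow> ('a, 'e) tangent" where
  "tscale a v = (\<lambda>c. a *\<^sub>R v c)"

definition vector_field ::
    "('a, 'e::euclidean_space) chart set \<Rightarrow> ('a \<Rightarrow> ('a, 'e) tangent) \<Rightarrow> bool" where
  "vector_field A X \<longleftrightarrow>
     (\<forall>p\<in>carrier A. X p \<in> tangent_space A p) \<and>
     (\<forall>c\<in>A. smooth_on (cimg c) (\<lambda>y. X (cinv c y) c))"

text \<open>The action \<open>v f\<close> of a tangent vector \<open>v\<close> at \<open>p\<close> on a function; it does not depend on the
  chart.\<close>

definition tangent_apply ::
    "('a, 'e::euclidean_space) chart set \<Rightarrow> 'a \<Rightarrow> ('a, 'e) tangent \<Rightarrow> ('a \<Rightarrow> real) \<Rightarrow> real" where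
  "tangent_apply A p v f =
     (let c = SOME c. c \<in> A \<and> p \<in> cdom c in frechet_derivative (f \<circ> cinv c) (at (cmap c p)) (v c))"

text \<open>\<open>[X, Y] = X Y - Y X\<close>, as derivations of germs of smooth functions.\<close>

definition lie_bracket ::
    "('a, 'e::euclidean_space) chart set \<Rightarrow> ('a \<Rightarrow> ('a, 'e) tangent) \<Rightarrow> ('a \<Rightarrow> ('a, 'e) tangent)
      \<Rightarrow> 'a \<Rightarrow> ('a, 'e) tangent" where
  "lie_bracket A X Y p = (THE z. z \<in> tangent_space A p \<and>
     (\<forall>U f. openin (mfd_topology A) U \<and> p \<in> U \<and> smooth_fun_on A U f \<longrightarrow>
        tangent_apply A p z f =
          tangent_apply A p (X p) (\<lambda>q. tangent_apply A q (Y q) f) -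
          tangent_apply A p (Y p) (\<lambda>q. tangent_apply A q (X q) f)))"


section \<open>Curves, integral curves and flows\<close>

definition has_velocity ::
    "('a, 'e::euclidean_space) chart set \<Rightarrow> (real \<Rightarrow> 'a) \<Rightarrow> real \<Rightarrow> ('a, 'e) tangent \<Rightarrow> bool" where
  "has_velocity A \<gamma> t v \<longleftrightarrow> v \<in> tangent_space A (\<gamma> t) \<and>
     (\<forall>c\<in>A. \<gamma> t \<in> cdom c \<longrightarrow> ((cmap c \<circ> \<gamma>) has_vector_derivative v c) (at t))"

definition curve_on ::
    "('a, 'e::euclidean_space) chart set \<Rightarrow> real set \<Rightarrow> (real \<Rightarrow> 'a) \<Rightarrow> bool" where
  "curve_on A J \<gamma> \<longleftrightarrow> open J \<and> is_interval J \<and> continuous_map (top_of_set J) (mfd_topology A) \<gamma>"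

definition integral_curve ::
    "('a, 'e::euclidean_space) chart set \<Rightarrow> ('a \<Rightarrow> ('a, 'e) tangent) \<Rightarrow> real set \<Rightarrow> (real \<Rightarrow> 'a) \<Rightarrow> bool"
  where
  "integral_curve A X J \<gamma> \<longleftrightarrow> curve_on A J \<gamma> \<and> (\<forall>t\<in>J. has_velocity A \<gamma> t (X (\<gamma> t)))"

definition flow_reaches ::
    "('a, 'e::euclidean_space) chart set \<Rightarrow> ('a \<Rightarrow> ('a, 'e) tangent) \<Rightarrow> real \<Rightarrow> 'a \<Rightarrow> 'a \<Rightarrow> bool" where
  "flow_reaches A X t p q \<longleftrightarrow>
     (\<exists>J \<gamma>. integral_curve A X J \<gamma> \<and> 0 \<in> J \<and> t \<in> J \<and> \<gamma> 0 = p \<and> \<gamma> t = q)"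

definition flow_defined ::
    "('a, 'e::euclidean_space) chart set \<Rightarrow> ('a \<Rightarrow> ('a, 'e) tangent) \<Rightarrow> real \<Rightarrow> 'a \<Rightarrow> bool" where
  "flow_defined A X t p \<longleftrightarrow> (\<exists>q. flow_reaches A X t p q)"

definition flow ::
    "('a, 'e::euclidean_space) chart set \<Rightarrow> ('a \<Rightarrow> ('a, 'e) tangent) \<Rightarrow> real \<Rightarrow> 'a \<Rightarrow> 'a" where
  "flow A X t p = (THE q. flow_reaches A X t p q)"


section \<open>Riemannian metrics, the Levi-Civita connection and the exponential map\<close>

type_synonym ('a, 'e) metric = "'a \<Rightarrow> ('a, 'e) tangent \<Rightarrow> ('a, 'e) tangent \<Rightarrow> real"

text \<open>The tangent vector at \<open>p\<close> whose representation in the chart \<open>c\<close> is \<open>u\<close>.\<close>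

definition tangent_of ::
    "('a, 'e::euclidean_space) chart set \<Rightarrow> ('a, 'e) chart \<Rightarrow> 'a \<Rightarrow> 'e \<Rightarrow> ('a, 'e) tangent" where
  "tangent_of A c p u = inv_into (tangent_space A p) (\<lambda>v. v c) u"

definition metric_coord ::
    "('a, 'e::euclidean_space) chart set \<Rightarrow> ('a, 'e) metric \<Rightarrow> ('a, 'e) chart \<Rightarrow> 'e \<Rightarrow> 'e \<Rightarrow> 'e \<Rightarrow> real"
  where
  "metric_coord A g c y u v =
     g (cinv c y) (tangent_of A c (cinv c y) u) (tangent_of A c (cinv c y) v)"

definition riemannian_metric ::
    "('a, 'e::euclidean_space) chart set \<Rightarrow> ('a, 'e) metric \<Rightarrow> bool" where
  "riemannian_metric A g \<longleftrightarrow>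
     (\<forall>p\<in>carrier A. \<forall>u\<in>tangent_space A p. \<forall>v\<in>tangent_space A p.
        g p u v = g p v u \<and>
        (\<forall>w\<in>tangent_space A p. g p (tadd u w) v = g p u v + g p w v) \<and>
        (\<forall>a. g p (tscale a u) v = a * g p u v) \<and>
        (u \<noteq> tzero \<longrightarrow> g p u u > 0)) \<and>
     (\<forall>c\<in>A. \<forall>u v. smooth_on (cimg c) (\<lambda>y. metric_coord A g c y u v))"

definition riemannian_manifold ::
    "('a, 'e::euclidean_space) chart set \<Rightarrow> ('a, 'e) metric \<Rightarrow> bool" where
  "riemannian_manifold A g \<longleftrightarrow> smooth_manifold A \<and> riemannian_metric A g"

text \<open>The Levi-Civita connection in the chart \<open>c\<close>: \<open>christoffel A g c y u v\<close> is the
  representation of \<open>\<nabla>\<^sub>u v\<close> at the point with coordinates \<open>y\<close>, where \<open>u\<close> and \<open>v\<close>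
  denote the vector fields with constant coordinates in \<open>c\<close>.  As these commute, torsion-freeness
  is the symmetry of \<open>B\<close>; the last clause is compatibility with the metric.\<close>

definition levi_civita_at ::
    "('a, 'e::euclidean_space) chart set \<Rightarrow> ('a, 'e) metric \<Rightarrow> ('a, 'e) chart \<Rightarrow> 'e
      \<Rightarrow> ('e \<Rightarrow> 'e \<Rightarrow> 'e) \<Rightarrow> bool" where
  "levi_civita_at A g c y B \<longleftrightarrow> bilinear B \<and> (\<forall>u v. B u v = B v u) \<and>
     (\<forall>u v w. frechet_derivative (\<lambda>z. metric_coord A g c z v w) (at y) u =
        metric_coord A g c y (B u v) w + metric_coord A g c y v (B u w))"

definition christoffel ::
    "('a, 'e::euclidean_space) chart set \<Rightarrow> ('a, 'e) metric \<Rightarrow> ('a, 'e) chart \<Rightarrow> 'e \<Rightarrow> 'e \<Rightarrow> 'e \<Rightarrow> 'e"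
  where
  "christoffel A g c y = (THE B. levi_civita_at A g c y B)"

text \<open>\<open>Z = D\<^sub>t W\<close> at time \<open>t\<close>, for a vector field \<open>W\<close> along the differentiable curve \<open>x\<close>; in a
  chart \<open>D\<^sub>t W = W' + \<Gamma>(x', W)\<close>.\<close>

definition has_covariant_derivative ::
    "('a, 'e::euclidean_space) chart set \<Rightarrow> ('a, 'e) metric \<Rightarrow> (real \<Rightarrow> 'a)
      \<Rightarrow> (real \<Rightarrow> ('a, 'e) tangent) \<Rightarrow> real \<Rightarrow> ('a, 'e) tangent \<Rightarrow> bool" where
  "has_covariant_derivative A g x W t Z \<longleftrightarrow> Z \<in> tangent_space A (x t) \<and>
     (\<forall>c\<in>A. x t \<in> cdom c \<longrightarrow>
        ((\<lambda>s. W s c) has_vector_derivative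
          Z c - christoffel A g c (cmap c (x t)) (vector_derivative (cmap c \<circ> x) (at t)) (W t c)) (at t))"

definition geodesic ::
    "('a, 'e::euclidean_space) chart set \<Rightarrow> ('a, 'e) metric \<Rightarrow> real set \<Rightarrow> (real \<Rightarrow> 'a) \<Rightarrow> bool" where
  "geodesic A g J \<gamma> \<longleftrightarrow> curve_on A J \<gamma> \<and>
     (\<exists>W. \<forall>t\<in>J. has_velocity A \<gamma> t (W t) \<and> has_covariant_derivative A g \<gamma> W t tzero)"

definition exp_reaches ::
    "('a, 'e::euclidean_space) chart set \<Rightarrow> ('a, 'e) metric \<Rightarrow> 'a \<Rightarrow> ('a, 'e) tangent \<Rightarrow> 'a \<Rightarrow> bool" where
  "exp_reaches A g x w y \<longleftrightarrow>
     (\<exists>J \<gamma>. geodesic A g J \<gamma> \<and> 0 \<in> J \<and> 1 \<in> J \<and> \<gamma> 0 = x \<and> has_velocity A \<gamma> 0 w \<and> \<gamma> 1 = y)"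

definition exp_domain ::
    "('a, 'e::euclidean_space) chart set \<Rightarrow> ('a, 'e) metric \<Rightarrow> 'a \<Rightarrow> ('a, 'e) tangent set" where
  "exp_domain A g x = {w. \<exists>y. exp_reaches A g x w y}"

definition exp_map ::
    "('a, 'e::euclidean_space) chart set \<Rightarrow> ('a, 'e) metric \<Rightarrow> 'a \<Rightarrow> ('a, 'e) tangent \<Rightarrow> 'a" where
  "exp_map A g x w = (THE y. exp_reaches A g x w y)"


section \<open>The manifold \<open>TM \<oplus> TM\<close> and the fields \<open>f\<^sub>1\<close>, \<open>f\<^sub>2\<close>\<close>

text \<open>Points are triples \<open>(x, V, R)\<close>; a chart \<open>c\<close> of \<open>M\<close> induces the chart
  \<open>(x, V, R) \<mapsto> (c x, V c, R c)\<close>.\<close>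

type_synonym ('a, 'e) tpair = "'a \<times> ('a, 'e) tangent \<times> ('a, 'e) tangent"

definition sum_chart ::
    "('a, 'e::euclidean_space) chart set \<Rightarrow> ('a, 'e) chart \<Rightarrow> (('a, 'e) tpair, 'e \<times> 'e \<times> 'e) chart" where
  "sum_chart A c =
     ({(x, V, R). x \<in> cdom c \<and> V \<in> tangent_space A x \<and> R \<in> tangent_space A x},
      \<lambda>(x, V, R). (cmap c x, V c, R c))"

definition sum_atlas ::
    "('a, 'e::euclidean_space) chart set \<Rightarrow> (('a, 'e) tpair, 'e \<times> 'e \<times> 'e) chart set" where
  "sum_atlas A = sum_chart A ` A"

definition bundle_proj :: "('a, 'e) tpair \<Rightarrow> 'a" where
  "bundle_proj = (\<lambda>(x, V, R). x)"

lemma carrier_sum_atlas: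
  "carrier (sum_atlas A) =
     {(x, V, R). x \<in> carrier A \<and> V \<in> tangent_space A x \<and> R \<in> tangent_space A x}"
  by (auto simp: carrier_def sum_atlas_def sum_chart_def cdom_def)

definition is_field_1 ::
    "('a, 'e::euclidean_space) chart set \<Rightarrow> ('a, 'e) metric
      \<Rightarrow> (('a, 'e) tpair \<Rightarrow> (('a, 'e) tpair, 'e \<times> 'e \<times> 'e) tangent) \<Rightarrow> bool" where
  "is_field_1 A g f \<longleftrightarrow> vector_field (sum_atlas A) f \<and>
     (\<forall>J x V R. integral_curve (sum_atlas A) f J (\<lambda>t. (x t, V t, R t)) \<longrightarrow>
        (\<forall>t\<in>J. has_velocity A x t (V t) \<and>
               has_covariant_derivative A g x R t (tscale (-1) (V t)) \<and>
               has_covariant_derivative A g x V t (R t)))"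

text \<open>Since \<open>x\<close> is constant here, \<open>R\<close> and \<open>V\<close> are curves in a fixed tangent space, and their
  derivatives are taken there.\<close>

definition is_field_2 ::
    "('a, 'e::euclidean_space) chart set
      \<Rightarrow> (('a, 'e) tpair \<Rightarrow> (('a, 'e) tpair, 'e \<times> 'e \<times> 'e) tangent) \<Rightarrow> bool" where
  "is_field_2 A f \<longleftrightarrow> vector_field (sum_atlas A) f \<and>
     (\<forall>J x V R. integral_curve (sum_atlas A) f J (\<lambda>t. (x t, V t, R t)) \<longrightarrow>
        (\<forall>t\<in>J. has_velocity A x t tzero \<and>
               (\<forall>c\<in>A. x t \<in> cdom c \<longrightarrow>
                  ((\<lambda>s. R s c) has_vector_derivative R t c) (at t) \<and>
                  ((\<lambda>s. V s c) has_vector_derivative V t c) (at t))))"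

end

theory Submission
  imports Defs
begin

text \<open>In the chart of \<open>TM \<oplus> TM\<close> induced by a chart of \<open>M\<close>, with Christoffel operator \<open>\<Gamma>\<close>, the fields are
  \<open>f1 = (V, R - \<Gamma>(V,V), -V - \<Gamma>(V,R))\<close> and \<open>f2 = (0, V, R)\<close>.  Computing the brackets with
  \<open>[X, Y] = DY(X) - DX(Y)\<close> gives
  \<open>f21 = (V, -\<Gamma>(V,V), -\<Gamma>(V,R))\<close> and \<open>f121 = (R, -\<Gamma>(R,V), -\<Gamma>(R,R))\<close>.
  So an integral curve of \<open>f21\<close> satisfies \<open>x' = V\<close>, \<open>D\<^sub>t V = 0\<close>, \<open>D\<^sub>t R = 0\<close>: its projection is the
  geodesic with initial velocity \<open>V\<close>.  For \<open>f121\<close> the roles of \<open>V\<close> and \<open>R\<close> are exchanged, and the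
  second claim reduces to the first by this symmetry.

  The statement speaks of all objects through definite descriptions, and resolving these is most of
  the work.  The fields are given by their integral curves, so their coordinates at a point require
  an integral curve through it (\<open>integral_curve_exists\<close>, by Picard iteration).  The bracket is
  given by a derivation, whose coordinate formula (\<open>lie_bracket_in_chart\<close>) is the symmetry of second
  derivatives.  The Christoffel operator is the unique solution of the Levi-Civita conditions at a
  point, bilinear by the Koszul formula (\<open>christoffel_bilinear\<close>).  Flow and exponential map are
  given by endpoints of curves, which are unique since \<open>TM \<oplus> TM\<close> is Hausdorff and \<open>f21\<close> is
  \<open>C\<^sup>1\<close> in charts (\<open>integral_curve_unique\<close>); a geodesic with velocity \<open>W\<close> is the projection of the
  integral curve \<open>(x, W, W)\<close> of \<open>f21\<close>.  The regularity of \<open>\<Gamma>\<close> is taken from that of \<open>f1\<close>.\<close>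

section \<open>Calculus of smooth maps\<close>

lemma has_derivative_frechet_derivative:
  "f differentiable (at x) \<Longrightarrow> (f has_derivative frechet_derivative f (at x)) (at x)"
  by (simp add: frechet_derivative_works)

lemma frechet_derivative_eqI:
  "(f has_derivative f') (at x) \<Longrightarrow> frechet_derivative f (at x) = f'"
  by (rule frechet_derivative_at [symmetric])

lemma frechet_derivative_cong_open:
  assumes "open S" "x \<in> S" "\<And>y. y \<in> S \<Longrightarrow> f y = g y"
  shows "frechet_derivative f (at x) = frechet_derivative g (at x)"
proof -
  have "(f has_derivative f') (at x) \<longleftrightarrow> (g has_derivative f') (at x)" for f'
    using has_derivative_transform_within_open [of f f' x UNIV S g]
      has_derivative_transform_within_open [of g f' x UNIV S f] assms by auto
  then show ?thesis unfolding frechet_derivative_def by simp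
qed

lemma differentiable_cong_open:
  assumes "open S" "x \<in> S" "\<And>y. y \<in> S \<Longrightarrow> f y = g y" "f differentiable (at x)"
  shows "g differentiable (at x)"
  using assms has_derivative_transform_within_open [of f _ x UNIV S g]
  unfolding differentiable_def by metis

lemma Ck_on_cong:
  assumes "open S" "\<And>x. x \<in> S \<Longrightarrow> f x = g x" "Ck_on k f S"
  shows "Ck_on k g S"
  using assms
proof (induction k arbitrary: f g)
  case 0
  then show ?case by (simp cong: continuous_on_cong)
next
  case (Suc k)
  have "g differentiable (at x)" if "x \<in> S" for x
    using Suc.prems that by (auto intro: differentiable_cong_open [where f = f])
  moreover have "Ck_on k (\<lambda>x. frechet_derivative g (at x) v) S" for v
  proof (rule Suc.IH [where f = "\<lambda>x. frechet_derivative f (at x) v"])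
    show "frechet_derivative f (at x) v = frechet_derivative g (at x) v" if "x \<in> S" for x
      using frechet_derivative_cong_open [of S x f g] Suc.prems that by auto
  qed (use Suc.prems in auto)
  ultimately show ?case by simp
qed

lemma Ck_on_Suc_imp: "Ck_on (Suc k) f S \<Longrightarrow> Ck_on k f S"
proof (induction k arbitrary: f)
  case 0
  then show ?case
    by (auto intro!: continuous_at_imp_continuous_on differentiable_imp_continuous_within)
next
  case (Suc k)
  from Suc.prems have "Ck_on (Suc k) (\<lambda>x. frechet_derivative f (at x) v) S" for v
    by (subst (asm) Ck_on.simps) blast
  then have "Ck_on k (\<lambda>x. frechet_derivative f (at x) v) S" for v by (rule Suc.IH)
  then show ?case using Suc.prems by simp
qed

lemma Ck_on_const: "Ck_on k (\<lambda>x. c) S"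
  by (induction k arbitrary: c) auto

lemma Ck_on_linear:
  assumes "bounded_linear L" shows "Ck_on k L S"
proof (cases k)
  case 0
  then show ?thesis using assms by (simp add: linear_continuous_on)
next
  case (Suc n)
  have "frechet_derivative L (at x) = L" for x
    by (rule frechet_derivative_eqI) (rule bounded_linear_imp_has_derivative [OF assms])
  then show ?thesis using Suc assms
    by (auto simp: Ck_on_const bounded_linear_imp_differentiable)
qed

lemma Ck_on_linear_compose:
  assumes "bounded_linear L" "open S" "Ck_on k f S"
  shows "Ck_on k (\<lambda>x. L (f x)) S"
  using assms(3)
proof (induction k arbitrary: f)
  case 0
  then show ?case
    using assms(1) by (simp add: bounded_linear.continuous_on)
next
  case (Suc k)
  have d: "((\<lambda>x. L (f x)) has_derivative (\<lambda>v. L (frechet_derivative f (at x) v))) (at x)"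
    if "x \<in> S" for x
    using Suc.prems that
    by (auto intro!: bounded_linear.has_derivative [OF assms(1)] has_derivative_frechet_derivative)
  have "Ck_on k (\<lambda>x. frechet_derivative (\<lambda>x. L (f x)) (at x) v) S" for v
  proof (rule Ck_on_cong [OF assms(2)])
    show "L (frechet_derivative f (at x) v) = frechet_derivative (\<lambda>x. L (f x)) (at x) v"
      if "x \<in> S" for x
      using frechet_derivative_eqI [OF d [OF that]] by simp
  qed (use Suc in auto)
  then show ?case using d by (auto simp: differentiable_def)
qed

lemma Ck_on_compose_linear:
  assumes "bounded_linear L" "open S" "L ` S \<subseteq> T" "Ck_on k f T"
  shows "Ck_on k (\<lambda>x. f (L x)) S"
  using assms(4)
proof (induction k arbitrary: f)
  case 0
  then show ?case
    using assms continuous_on_compose2 [of T f S L] by (simp add: linear_continuous_on)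
next
  case (Suc k)
  have d: "((\<lambda>x. f (L x)) has_derivative (\<lambda>v. frechet_derivative f (at (L x)) (L v))) (at x)"
    if "x \<in> S" for x
    using Suc.prems that assms(3)
    by (intro has_derivative_compose [OF bounded_linear_imp_has_derivative [OF assms(1)]]
         has_derivative_frechet_derivative) auto
  have "Ck_on k (\<lambda>x. frechet_derivative (\<lambda>x. f (L x)) (at x) v) S" for v
  proof (rule Ck_on_cong [OF assms(2)])
    show "frechet_derivative f (at (L x)) (L v) = frechet_derivative (\<lambda>x. f (L x)) (at x) v"
      if "x \<in> S" for x
      using frechet_derivative_eqI [OF d [OF that]] by simp
    show "Ck_on k (\<lambda>x. frechet_derivative f (at (L x)) (L v)) S"
      using Suc.IH [of "\<lambda>x. frechet_derivative f (at x) (L v)"] Suc.prems by simp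
  qed
  then show ?case using d by (auto simp: differentiable_def)
qed

lemma Ck_on_add:
  assumes "open S" "Ck_on k f S" "Ck_on k g S"
  shows "Ck_on k (\<lambda>x. f x + g x) S"
  using assms(2,3)
proof (induction k arbitrary: f g)
  case 0
  then show ?case by (simp add: continuous_on_add)
next
  case (Suc k)
  have d: "((\<lambda>x. f x + g x) has_derivative
      (\<lambda>v. frechet_derivative f (at x) v + frechet_derivative g (at x) v)) (at x)" if "x \<in> S" for x
    using Suc.prems that
    by (auto intro!: has_derivative_add has_derivative_frechet_derivative)
  have "Ck_on k (\<lambda>x. frechet_derivative (\<lambda>x. f x + g x) (at x) v) S" for v
  proof (rule Ck_on_cong [OF assms(1)])
    show "frechet_derivative f (at x) v + frechet_derivative g (at x) v =
        frechet_derivative (\<lambda>x. f x + g x) (at x) v" if "x \<in> S" for x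
      using frechet_derivative_eqI [OF d [OF that]] by simp
  qed (use Suc in auto)
  then show ?case using d by (auto simp: differentiable_def)
qed

lemma Ck_on_sum:
  assumes "open S" "\<And>i. i \<in> I \<Longrightarrow> Ck_on k (f i) S"
  shows "Ck_on k (\<lambda>x. \<Sum>i\<in>I. f i x) S"
  using assms(2)
  by (induction I rule: infinite_finite_induct) (simp_all add: Ck_on_const Ck_on_add [OF assms(1)])

lemma Ck_on_scaleR:
  assumes "open S" "Ck_on k f S" "Ck_on k g S"
  shows "Ck_on k (\<lambda>x. f x *\<^sub>R g x) S"
  using assms(2,3)
proof (induction k arbitrary: f g)
  case 0
  then show ?case by (simp add: continuous_on_scaleR)
next
  case (Suc k)
  have d: "((\<lambda>x. f x *\<^sub>R g x) has_derivative
      (\<lambda>v. f x *\<^sub>R frechet_derivative g (at x) v + frechet_derivative f (at x) v *\<^sub>R g x)) (at x)"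
    if "x \<in> S" for x
    using Suc.prems that
    by (auto intro!: has_derivative_scaleR has_derivative_frechet_derivative)
  have "Ck_on k (\<lambda>x. frechet_derivative (\<lambda>x. f x *\<^sub>R g x) (at x) v) S" for v
  proof (rule Ck_on_cong [OF assms(1)])
    show "f x *\<^sub>R frechet_derivative g (at x) v + frechet_derivative f (at x) v *\<^sub>R g x =
        frechet_derivative (\<lambda>x. f x *\<^sub>R g x) (at x) v" if "x \<in> S" for x
      using frechet_derivative_eqI [OF d [OF that]] by simp
    show "Ck_on k (\<lambda>x. f x *\<^sub>R frechet_derivative g (at x) v +
        frechet_derivative f (at x) v *\<^sub>R g x) S"
      using Suc.prems Suc.IH Ck_on_Suc_imp [of k f S] Ck_on_Suc_imp [of k g S]
      by (auto intro!: Ck_on_add [OF assms(1)])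
  qed
  then show ?case using d by (auto simp: differentiable_def)
qed

lemma Ck_on_Pair:
  assumes "open S" "Ck_on k f S" "Ck_on k g S"
  shows "Ck_on k (\<lambda>x. (f x, g x)) S"
proof -
  have l: "bounded_linear (\<lambda>u::'b. (u, 0::'c))" "bounded_linear (\<lambda>w::'c. (0::'b, w))"
    by (intro bounded_linear_intros)+
  have "Ck_on k (\<lambda>x. (f x, 0) + (0, g x)) S"
    by (rule Ck_on_add [OF assms(1) Ck_on_linear_compose [OF l(1) assms(1,2)]
          Ck_on_linear_compose [OF l(2) assms(1,3)]])
  then show ?thesis by simp
qed

lemma smooth_on_imp_differentiable:
  "smooth_on S f \<Longrightarrow> x \<in> S \<Longrightarrow> f differentiable (at x)"
  unfolding smooth_on_def by (drule spec [of _ "Suc 0"]) simp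

lemma smooth_on_frechet_derivative:
  "smooth_on S f \<Longrightarrow> smooth_on S (\<lambda>x. frechet_derivative f (at x) v)"
  unfolding smooth_on_def by (intro allI, drule_tac x = "Suc k" in spec) simp

lemma smooth_on_cong:
  "open S \<Longrightarrow> (\<And>x. x \<in> S \<Longrightarrow> f x = g x) \<Longrightarrow> smooth_on S f \<Longrightarrow> smooth_on S g"
  unfolding smooth_on_def using Ck_on_cong by blast

lemma linear_eq_sum_Basis:
  fixes L :: "'a::euclidean_space \<Rightarrow> 'b::real_vector"
  assumes "linear L" shows "L v = (\<Sum>b\<in>Basis. (v \<bullet> b) *\<^sub>R L b)"
proof -
  have "L v = L (\<Sum>b\<in>Basis. (v \<bullet> b) *\<^sub>R b)" by (simp add: euclidean_representation)
  then show ?thesis using assms by (simp add: linear_sum linear_cmul)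
qed

text \<open>A coordinate expression \<open>(y, v) \<mapsto> D\<tau>(y) v\<close> is smooth because it is linear in \<open>v\<close>, hence
  a finite combination of the smooth maps \<open>y \<mapsto> D\<tau>(y) b\<close> over basis vectors \<open>b\<close>.\<close>

lemma smooth_on_frechet_derivative_apply:
  fixes \<tau> :: "'a::euclidean_space \<Rightarrow> 'b::euclidean_space"
    and P Q :: "'c::real_normed_vector \<Rightarrow> 'a"
  assumes "smooth_on T \<tau>" "open S" "bounded_linear P" "bounded_linear Q" "P ` S \<subseteq> T"
  shows "smooth_on S (\<lambda>z. frechet_derivative \<tau> (at (P z)) (Q z))"
proof (rule smooth_on_cong [OF assms(2)])
  show "(\<Sum>b\<in>Basis. (Q z \<bullet> b) *\<^sub>R frechet_derivative \<tau> (at (P z)) b) =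
      frechet_derivative \<tau> (at (P z)) (Q z)" if "z \<in> S" for z
    using that assms(1,5)
    by (intro linear_eq_sum_Basis [symmetric] linear_frechet_derivative
         smooth_on_imp_differentiable [where S = T]) auto
  have "bounded_linear (\<lambda>z. Q z \<bullet> b)" for b
    by (rule bounded_linear_compose [OF bounded_linear_inner_left assms(4)])
  moreover have "Ck_on k (\<lambda>z. frechet_derivative \<tau> (at (P z)) b) S" for k b
    using smooth_on_frechet_derivative [OF assms(1)] unfolding smooth_on_def
    by (intro Ck_on_compose_linear [OF assms(3,2,5)]) auto
  ultimately show "smooth_on S (\<lambda>z. \<Sum>b\<in>Basis. (Q z \<bullet> b) *\<^sub>R frechet_derivative \<tau> (at (P z)) b)"
    unfolding smooth_on_def
    by (intro allI Ck_on_sum Ck_on_scaleR assms(2)) (auto intro: Ck_on_linear)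
qed

lemma frechet_derivative_along_line:
  assumes "F differentiable (at (p + s *\<^sub>R w))"
  shows "((\<lambda>s. F (p + s *\<^sub>R w)) has_vector_derivative frechet_derivative F (at (p + s *\<^sub>R w)) w) (at s)"
proof -
  have "((\<lambda>s. p + s *\<^sub>R w) has_derivative (\<lambda>s. s *\<^sub>R w)) (at (s::real))"
    by (auto intro!: derivative_eq_intros)
  then have "((\<lambda>s. F (p + s *\<^sub>R w)) has_derivative
      (\<lambda>u. frechet_derivative F (at (p + s *\<^sub>R w)) (u *\<^sub>R w))) (at s)"
    by (rule has_derivative_compose) (rule has_derivative_frechet_derivative [OF assms])
  then show ?thesis
    unfolding has_vector_derivative_def
    by (simp add: linear_cmul [OF linear_frechet_derivative [OF assms]])
qed

text \<open>The mean value theorem, applied first in direction \<open>v\<close> and then in direction \<open>w\<close>.  The second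
  difference is symmetric in \<open>v\<close> and \<open>w\<close>, so it is expressed by either mixed derivative, and the
  two agree in the limit \<open>h \<longlongrightarrow> 0\<close>.\<close>

lemma second_difference_mean_value:
  fixes F :: "'a::euclidean_space \<Rightarrow> real"
  assumes F: "Ck_on 2 F S" and h: "h > 0"
    and S: "\<And>s t. 0 \<le> s \<Longrightarrow> s \<le> h \<Longrightarrow> 0 \<le> t \<Longrightarrow> t \<le> h \<Longrightarrow> x + s *\<^sub>R v + t *\<^sub>R w \<in> S"
  shows "\<exists>s t. 0 < s \<and> s < h \<and> 0 < t \<and> t < h \<and>
    F (x + h *\<^sub>R v + h *\<^sub>R w) - F (x + h *\<^sub>R v) - F (x + h *\<^sub>R w) + F x =
      h\<^sup>2 * frechet_derivative (\<lambda>y. frechet_derivative F (at y) v) (at (x + s *\<^sub>R v + t *\<^sub>R w)) w"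
proof -
  let ?Dv = "\<lambda>y. frechet_derivative F (at y) v"
  have dF: "F differentiable (at y)" "?Dv differentiable (at y)" if "y \<in> S" for y
    using F that by (simp_all add: numeral_2_eq_2)
  let ?\<phi> = "\<lambda>s. F ((x + h *\<^sub>R w) + s *\<^sub>R v) - F (x + s *\<^sub>R v)"
  have d1: "DERIV ?\<phi> s :> ?Dv ((x + h *\<^sub>R w) + s *\<^sub>R v) - ?Dv (x + s *\<^sub>R v)"
    if "0 \<le> s" "s \<le> h" for s
    unfolding has_real_derivative_iff_has_vector_derivative
    using S [OF that, of h] S [OF that, of 0] h
    by (intro has_vector_derivative_diff frechet_derivative_along_line dF)
      (simp_all add: algebra_simps)
  obtain s where s: "0 < s" "s < h"
    and e1: "?\<phi> h - ?\<phi> 0 = (h - 0) * (?Dv ((x + h *\<^sub>R w) + s *\<^sub>R v) - ?Dv (x + s *\<^sub>R v))"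
    using MVT2 [of 0 h ?\<phi> "\<lambda>s. ?Dv ((x + h *\<^sub>R w) + s *\<^sub>R v) - ?Dv (x + s *\<^sub>R v)"] h d1 by blast
  let ?p = "x + s *\<^sub>R v"
  have d2: "DERIV (\<lambda>t. ?Dv (?p + t *\<^sub>R w)) t :> frechet_derivative ?Dv (at (?p + t *\<^sub>R w)) w"
    if "0 \<le> t" "t \<le> h" for t
    unfolding has_real_derivative_iff_has_vector_derivative
    using S [of s t] s that
    by (intro frechet_derivative_along_line dF) simp_all
  obtain t where t: "0 < t" "t < h"
    and e2: "?Dv (?p + h *\<^sub>R w) - ?Dv (?p + 0 *\<^sub>R w) =
      (h - 0) * frechet_derivative ?Dv (at (?p + t *\<^sub>R w)) w"
    using MVT2 [of 0 h "\<lambda>t. ?Dv (?p + t *\<^sub>R w)", OF h d2] by blast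
  have swap: "x + h *\<^sub>R w + s *\<^sub>R v = ?p + h *\<^sub>R w" by (simp add: algebra_simps)
  have "?\<phi> h - ?\<phi> 0 = h * (?Dv (?p + h *\<^sub>R w) - ?Dv (?p + 0 *\<^sub>R w))"
    using e1 unfolding swap by simp
  also have "\<dots> = h\<^sup>2 * frechet_derivative ?Dv (at (?p + t *\<^sub>R w)) w"
    unfolding e2 by (simp add: power2_eq_square)
  finally have "?\<phi> h - ?\<phi> 0 = h\<^sup>2 * frechet_derivative ?Dv (at (?p + t *\<^sub>R w)) w" .
  moreover have "x + h *\<^sub>R w + h *\<^sub>R v = x + h *\<^sub>R v + h *\<^sub>R w" by (simp add: algebra_simps)
  ultimately show ?thesis using s t by (intro exI [of _ s] exI [of _ t]) (simp add: algebra_simps)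
qed

lemma second_derivative_symmetric:
  fixes F :: "'a::euclidean_space \<Rightarrow> real"
  assumes F: "Ck_on 2 F S" and "open S" "x \<in> S"
  shows "frechet_derivative (\<lambda>y. frechet_derivative F (at y) v) (at x) w =
    frechet_derivative (\<lambda>y. frechet_derivative F (at y) w) (at x) v"
    (is "?A x = ?B x")
proof (rule ccontr)
  assume ne: "?A x \<noteq> ?B x"
  have cont: "continuous_on S ?A" "continuous_on S ?B"
    using F by (simp_all add: numeral_2_eq_2)
  define e where "e = dist (?A x) (?B x) / 2"
  have "e > 0" using ne by (simp add: e_def)
  have "isCont ?A x" "isCont ?B x"
    using cont assms(2,3) by (simp_all add: continuous_on_eq_continuous_at)
  then have "(?A \<longlongrightarrow> ?A x) (nhds x)" "(?B \<longlongrightarrow> ?B x) (nhds x)"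
    by (auto intro: tendsto_at_iff_tendsto_nhds [THEN iffD1] dest: isContD)
  then have "\<forall>\<^sub>F y in nhds x. dist (?A y) (?A x) < e" "\<forall>\<^sub>F y in nhds x. dist (?B y) (?B x) < e"
    using \<open>e > 0\<close> by (simp_all add: tendstoD)
  then have "\<forall>\<^sub>F y in nhds x. y \<in> S \<and> dist (?A y) (?A x) < e \<and> dist (?B y) (?B x) < e"
    using eventually_nhds_in_open [OF assms(2,3)] by eventually_elim auto
  then obtain d where "d > 0"
    and d: "\<And>y. dist y x < d \<Longrightarrow> y \<in> S \<and> dist (?A y) (?A x) < e \<and> dist (?B y) (?B x) < e"
    unfolding eventually_nhds_metric by blast
  \<comment> \<open>small enough for the parallelogram spanned by \<open>h v\<close> and \<open>h w\<close> to stay within distance \<open>d\<close> of \<open>x\<close>\<close>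
  define h where "h = d / (2 * (norm v + norm w + 1))"
  have pos: "norm v + norm w + 1 > 0" by (simp add: add_nonneg_pos)
  then have "h > 0" using \<open>d > 0\<close> by (simp add: h_def)
  have near: "dist (x + s *\<^sub>R v + t *\<^sub>R w) x < d" if "0 \<le> s" "s \<le> h" "0 \<le> t" "t \<le> h" for s t
  proof -
    have "dist (x + s *\<^sub>R v + t *\<^sub>R w) x = norm (s *\<^sub>R v + t *\<^sub>R w)" by (simp add: dist_norm)
    also have "\<dots> \<le> s * norm v + t * norm w"
      using that norm_triangle_ineq [of "s *\<^sub>R v" "t *\<^sub>R w"] by simp
    also have "\<dots> \<le> h * norm v + h * norm w" using that by (intro add_mono mult_right_mono) auto
    also have "\<dots> < h * (2 * (norm v + norm w + 1))"
    proof -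
      have "0 < h * (norm v + norm w + 2)" using \<open>h > 0\<close> pos by simp
      then show ?thesis by (simp add: algebra_simps)
    qed
    also have "\<dots> = d" using pos by (simp add: h_def)
    finally show ?thesis .
  qed
  obtain s t where st: "0 < s" "s < h" "0 < t" "t < h"
    and A: "F (x + h *\<^sub>R v + h *\<^sub>R w) - F (x + h *\<^sub>R v) - F (x + h *\<^sub>R w) + F x =
        h\<^sup>2 * ?A (x + s *\<^sub>R v + t *\<^sub>R w)"
    using second_difference_mean_value [OF F \<open>h > 0\<close>, of x v w] near d by blast
  have near': "dist (x + s *\<^sub>R w + t *\<^sub>R v) x < d" if "0 \<le> s" "s \<le> h" "0 \<le> t" "t \<le> h" for s t
    using near [OF that(3,4,1,2)] by (simp add: algebra_simps)
  obtain s' t' where st': "0 < s'" "s' < h" "0 < t'" "t' < h"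
    and B: "F (x + h *\<^sub>R w + h *\<^sub>R v) - F (x + h *\<^sub>R w) - F (x + h *\<^sub>R v) + F x =
        h\<^sup>2 * ?B (x + s' *\<^sub>R w + t' *\<^sub>R v)"
    using second_difference_mean_value [OF F \<open>h > 0\<close>, of x w v] near' d by blast
  have swap: "x + h *\<^sub>R w + h *\<^sub>R v = x + h *\<^sub>R v + h *\<^sub>R w" by (simp add: algebra_simps)
  have "h\<^sup>2 * ?A (x + s *\<^sub>R v + t *\<^sub>R w) = h\<^sup>2 * ?B (x + s' *\<^sub>R w + t' *\<^sub>R v)"
    using A B unfolding swap by linarith
  then have eq: "?A (x + s *\<^sub>R v + t *\<^sub>R w) = ?B (x + s' *\<^sub>R w + t' *\<^sub>R v)" using \<open>h > 0\<close> by simp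
  have "dist (?A (x + s *\<^sub>R v + t *\<^sub>R w)) (?A x) < e" "dist (?B (x + s' *\<^sub>R w + t' *\<^sub>R v)) (?B x) < e"
    using d near [of s t] near' [of s' t'] st st' by auto
  then have "dist (?A x) (?B x) < 2 * e"
    unfolding eq dist_real_def by linarith
  then show False by (simp add: e_def)
qed

text \<open>The product rule, applied after expanding \<open>DF(y) (Y y)\<close> over a basis into products of components
  of \<open>Y\<close> and partial derivatives of \<open>F\<close>.\<close>

lemma derivative_of_directional_derivative:
  fixes F :: "'a::euclidean_space \<Rightarrow> real" and Y :: "'a \<Rightarrow> 'a"
  assumes F: "Ck_on 2 F S" and "open S" "x \<in> S" and Y: "Y differentiable (at x)"
  shows "((\<lambda>y. frechet_derivative F (at y) (Y y)) has_derivative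
    (\<lambda>h. frechet_derivative (\<lambda>y. frechet_derivative F (at y) (Y x)) (at x) h +
      frechet_derivative F (at x) (frechet_derivative Y (at x) h))) (at x)"
proof -
  let ?D = "\<lambda>y. frechet_derivative F (at y)"
  let ?E = "\<lambda>b. frechet_derivative (\<lambda>y. ?D y b) (at x)"
  have lin: "linear (?D y)" if "y \<in> S" for y
    using F that by (intro linear_frechet_derivative) (simp add: numeral_2_eq_2)
  have dE: "((\<lambda>y. ?D y b) has_derivative ?E b) (at x)" for b
    using F assms(3) by (intro has_derivative_frechet_derivative) (simp add: numeral_2_eq_2)
  have dY: "(Y has_derivative frechet_derivative Y (at x)) (at x)"
    using Y by (rule has_derivative_frechet_derivative)
  have exp: "?D y u = (\<Sum>b\<in>Basis. (u \<bullet> b) * ?D y b)" if "y \<in> S" for y u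
    by (subst linear_eq_sum_Basis [OF lin [OF that]]) simp
  have "((\<lambda>y. \<Sum>b\<in>Basis. (Y y \<bullet> b) * ?D y b) has_derivative
     (\<lambda>h. \<Sum>b\<in>Basis. (Y x \<bullet> b) * ?E b h + (frechet_derivative Y (at x) h \<bullet> b) * ?D x b)) (at x)"
    by (intro has_derivative_sum has_derivative_mult has_derivative_inner_left dY dE)
  then have "((\<lambda>y. ?D y (Y y)) has_derivative
     (\<lambda>h. \<Sum>b\<in>Basis. (Y x \<bullet> b) * ?E b h + (frechet_derivative Y (at x) h \<bullet> b) * ?D x b)) (at x)"
    by (rule has_derivative_transform_within_open [OF _ assms(2,3)]) (rule exp [symmetric])
  moreover have "frechet_derivative (\<lambda>y. ?D y (Y x)) (at x) = (\<lambda>h. \<Sum>b\<in>Basis. (Y x \<bullet> b) * ?E b h)"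
  proof (rule frechet_derivative_eqI)
    have "((\<lambda>y. \<Sum>b\<in>Basis. (Y x \<bullet> b) * ?D y b) has_derivative
     (\<lambda>h. \<Sum>b\<in>Basis. (Y x \<bullet> b) * ?E b h)) (at x)"
      by (intro has_derivative_sum has_derivative_mult_right dE)
    then show "((\<lambda>y. ?D y (Y x)) has_derivative (\<lambda>h. \<Sum>b\<in>Basis. (Y x \<bullet> b) * ?E b h)) (at x)"
      by (rule has_derivative_transform_within_open [OF _ assms(2,3)]) (rule exp [symmetric])
  qed
  moreover have "?D x (frechet_derivative Y (at x) h) =
      (\<Sum>b\<in>Basis. (frechet_derivative Y (at x) h \<bullet> b) * ?D x b)" for h
    by (rule exp [OF assms(3)])
  ultimately show ?thesis
    by (simp only: sum.distrib)
qed

text \<open>Second derivatives cancel by symmetry: the commutator of two derivations along vector fields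
  is again a derivation along a vector field.\<close>

lemma commutator_of_directional_derivatives:
  fixes F :: "'a::euclidean_space \<Rightarrow> real" and X Y :: "'a \<Rightarrow> 'a"
  assumes F: "Ck_on 2 F S" and S: "open S" "x \<in> S"
    and X: "X differentiable (at x)" and Y: "Y differentiable (at x)"
  shows "frechet_derivative (\<lambda>y. frechet_derivative F (at y) (Y y)) (at x) (X x) -
    frechet_derivative (\<lambda>y. frechet_derivative F (at y) (X y)) (at x) (Y x) =
    frechet_derivative F (at x)
      (frechet_derivative Y (at x) (X x) - frechet_derivative X (at x) (Y x))"
proof -
  have "linear (frechet_derivative F (at x))"
    using F S by (intro linear_frechet_derivative) (simp add: numeral_2_eq_2)
  then show ?thesis
    unfolding frechet_derivative_eqI [OF derivative_of_directional_derivative [OF F S X]]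
      frechet_derivative_eqI [OF derivative_of_directional_derivative [OF F S Y]]
      second_derivative_symmetric [OF F S, of "Y x" "X x"]
    by (simp add: linear_diff)
qed

text \<open>Continuity of the partial derivatives bounds the operator norm of the derivative on a compact
  ball, which by the mean value inequality gives a Lipschitz constant.\<close>

lemma C1_locally_lipschitz:
  fixes F :: "'a::euclidean_space \<Rightarrow> 'b::real_normed_vector"
  assumes F: "Ck_on 1 F S" and S: "open S" "x \<in> S"
  obtains r L where "r > 0" "L > 0" "cball x r \<subseteq> S"
    "\<And>u w. u \<in> cball x r \<Longrightarrow> w \<in> cball x r \<Longrightarrow> norm (F u - F w) \<le> L * norm (u - w)"
proof -
  obtain r where r: "r > 0" "cball x r \<subseteq> S" using S open_contains_cball by blast
  let ?D = "\<lambda>y. frechet_derivative F (at y)"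
  have "continuous_on (cball x r) (\<lambda>y. \<Sum>b\<in>Basis. norm (?D y b))"
    using F r by (intro continuous_intros) (auto intro: continuous_on_subset)
  then have "bounded ((\<lambda>y. \<Sum>b\<in>Basis. norm (?D y b)) ` cball x r)"
    by (intro compact_imp_bounded compact_continuous_image) auto
  then obtain L where "L > 0"
    and "\<forall>z\<in>(\<lambda>y. \<Sum>b\<in>Basis. norm (?D y b)) ` cball x r. norm z \<le> L"
    unfolding bounded_pos by blast
  then have L: "(\<Sum>b\<in>Basis. norm (?D y b)) \<le> L" if "y \<in> cball x r" for y
  proof -
    have "norm (\<Sum>b\<in>Basis. norm (?D y b)) \<le> L" using that \<open>\<forall>z\<in>_. norm z \<le> L\<close> by blast
    then show ?thesis by (simp only: real_norm_def abs_le_D1)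
  qed
  have dF: "F differentiable (at y)" if "y \<in> cball x r" for y
    using F r that by auto
  have "norm (F u - F w) \<le> L * norm (u - w)" if "u \<in> cball x r" "w \<in> cball x r" for u w
  proof (rule differentiable_bound [OF convex_cball _ _ that])
    fix y assume y: "y \<in> cball x r"
    show "(F has_derivative ?D y) (at y within cball x r)"
      using has_derivative_frechet_derivative [OF dF [OF y]] by (rule has_derivative_at_withinI)
    show "onorm (?D y) \<le> L"
    proof (rule onorm_le)
      fix v
      have "norm (?D y v) = norm (\<Sum>b\<in>Basis. (v \<bullet> b) *\<^sub>R ?D y b)"
        by (subst linear_eq_sum_Basis [OF linear_frechet_derivative [OF dF [OF y]]]) simp
      also have "\<dots> \<le> (\<Sum>b\<in>Basis. norm v * norm (?D y b))"
        by (intro sum_norm_le) (auto intro!: mult_right_mono Basis_le_norm)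
      also have "\<dots> \<le> norm v * L"
        using L [OF y] by (simp flip: sum_distrib_left add: mult_left_mono)
      finally show "norm (?D y v) \<le> L * norm v" by (simp add: mult.commute)
    qed
  qed
  then show ?thesis using r \<open>L > 0\<close> that by blast
qed


section \<open>Ordinary differential equations in Euclidean space\<close>

text \<open>Picard iteration.  Integrals start at \<open>-d\<close> so that one formula covers both signs of \<open>t\<close>;
  the contraction constant is then \<open>4dL\<close>, whence the choice \<open>d = 1/(8L)\<close>.\<close>

lemma picard_lipschitz:
  fixes G :: "'a::euclidean_space \<Rightarrow> 'a"
  assumes L: "L > 0" and lip: "\<And>u w. norm (G u - G w) \<le> L * norm (u - w)"
  obtains d u where "d > 0" "u 0 = y0"
    "\<And>t. t \<in> {-d<..<d} \<Longrightarrow> (u has_vector_derivative G (u t)) (at t)"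
proof -
  define d where "d = 1 / (8 * L)"
  have d: "d > 0" using L by (simp add: d_def)
  define T :: "(real \<Rightarrow>\<^sub>C 'a) \<Rightarrow> real \<Rightarrow> 'a" where
    "T u t = y0 + integral {-d..t} (\<lambda>s. G (apply_bcontfun u s)) -
      integral {-d..0} (\<lambda>s. G (apply_bcontfun u s))" for u t
  have contG: "continuous_on X G" for X
  proof -
    have "L-lipschitz_on X G"
      using lip L by (auto intro!: lipschitz_onI simp: dist_norm)
    then show ?thesis by (rule lipschitz_on_continuous_on)
  qed
  have cont: "continuous_on X (\<lambda>s. G (apply_bcontfun u s))" for X and u :: "real \<Rightarrow>\<^sub>C 'a"
    by (rule continuous_on_compose2 [OF contG [of UNIV]]) auto
  have deriv: "(T u has_vector_derivative G (apply_bcontfun u t)) (at t within {-d..d})"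
    if "t \<in> {-d..d}" for u t
    unfolding T_def using integral_has_vector_derivative [OF cont that, of u]
    by (auto intro!: derivative_eq_intros)
  have contT: "continuous_on (cbox (-d) d) (T u)" for u
    unfolding continuous_on_eq_continuous_within
    by (auto intro!: has_vector_derivative_continuous deriv)
  define P where "P u = Bcontfun (\<lambda>t. T u (clamp (-d) d t))" for u
  have "(\<lambda>t. T u (clamp (-d) d t)) \<in> bcontfun" for u
    using clamp_continuous_on [OF contT]
      clamp_bounded [OF compact_imp_bounded [OF compact_continuous_image [OF contT compact_cbox]]]
    by (simp add: bcontfun_def)
  then have P: "apply_bcontfun (P u) t = T u (clamp (-d) d t)" for u t
    by (simp add: P_def Bcontfun_inverse)
  have "dist (P u) (P w) \<le> (1/2) * dist u w" for u w
  proof (rule dist_bound)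
    fix t
    define c where "c = clamp (-d) d t"
    have c: "-d \<le> c" "c \<le> d" using clamp_in_interval [of "-d" d t] d by (auto simp: c_def)
    let ?h = "\<lambda>s. G (apply_bcontfun u s) - G (apply_bcontfun w s)"
    have bound: "norm (integral {-d..s} ?h) \<le> dist u w / 4" if "-d \<le> s" "s \<le> d" for s
    proof -
      have "norm (integral {-d..s} ?h) \<le> (L * dist u w) * (s - -d)"
      proof (rule integral_bound [OF that(1)])
        show "continuous_on {-d..s} ?h" by (intro continuous_on_diff cont)
        show "norm (?h x) \<le> L * dist u w" for x
          using lip [of "apply_bcontfun u x" "apply_bcontfun w x"] L dist_bounded [of u x w]
          by (smt (verit, best) dist_norm mult_left_mono)
      qed
      also have "\<dots> \<le> (L * dist u w) * (2 * d)" using that L by (intro mult_left_mono) auto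
      also have "\<dots> = dist u w / 4" using L by (simp add: d_def)
      finally show ?thesis .
    qed
    have int: "integral {-d..s} ?h =
        integral {-d..s} (\<lambda>s. G (apply_bcontfun u s)) - integral {-d..s} (\<lambda>s. G (apply_bcontfun w s))" for s
      by (intro integral_diff integrable_continuous_interval cont)
    have "dist (apply_bcontfun (P u) t) (apply_bcontfun (P w) t) =
        norm (integral {-d..c} ?h - integral {-d..0} ?h)"
      unfolding P c_def [symmetric] int dist_norm T_def by (simp add: algebra_simps)
    also have "\<dots> \<le> (1/2) * dist u w"
      using bound [of c] bound [of 0] c d norm_triangle_ineq4 [of "integral {-d..c} ?h" "integral {-d..0} ?h"]
      by linarith
    finally show "dist (apply_bcontfun (P u) t) (apply_bcontfun (P w) t) \<le> (1/2) * dist u w" .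
  qed
  then obtain u where u: "P u = u"
    using banach_fix_type [of "1/2" P] by auto
  have fix_T: "apply_bcontfun u t = T u t" if "t \<in> {-d..d}" for t
    using P [of u t] that by (simp add: u)
  show thesis
  proof (rule that [OF d])
    show "apply_bcontfun u 0 = y0" using fix_T [of 0] d by (simp add: T_def)
    fix t assume t: "t \<in> {-d<..<d}"
    then have "(T u has_vector_derivative G (apply_bcontfun u t)) (at t)"
      using deriv [of t u] by (simp add: at_within_Icc_at)
    then show "(apply_bcontfun u has_vector_derivative G (apply_bcontfun u t)) (at t)"
      by (rule has_vector_derivative_transform_within_open [where S = "{-d<..<d}"])
        (use t in \<open>auto simp: fix_T\<close>)
  qed
qed

text \<open>A \<open>C\<^sup>1\<close> field is Lipschitz on a small ball; composing it with the nearest-point projection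
  onto that ball makes it globally Lipschitz, and the solution stays in the ball for a short time.\<close>

lemma ode_local_existence:
  fixes F :: "'a::euclidean_space \<Rightarrow> 'a"
  assumes F: "Ck_on 1 F S" and S: "open S" "y0 \<in> S"
  obtains d u where "d > 0" "u 0 = y0" "\<And>t. t \<in> {-d<..<d} \<Longrightarrow> u t \<in> S"
    "\<And>t. t \<in> {-d<..<d} \<Longrightarrow> (u has_vector_derivative F (u t)) (at t)"
proof -
  obtain r L where rL: "r > 0" "L > 0" "cball y0 r \<subseteq> S"
    and lip: "\<And>u w. u \<in> cball y0 r \<Longrightarrow> w \<in> cball y0 r \<Longrightarrow> norm (F u - F w) \<le> L * norm (u - w)"
    using C1_locally_lipschitz [OF F S] by blast
  let ?B = "cball y0 r"
  have ne: "?B \<noteq> {}" using rL by auto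
  let ?G = "\<lambda>u. F (closest_point ?B u)"
  have "norm (?G u - ?G w) \<le> L * norm (u - w)" for u w
  proof -
    have "norm (?G u - ?G w) \<le> L * norm (closest_point ?B u - closest_point ?B w)"
      by (intro lip closest_point_in_set ne closed_cball)
    also have "\<dots> \<le> L * norm (u - w)"
      using closest_point_lipschitz [OF convex_cball closed_cball ne, of u w] rL(2)
      by (intro mult_left_mono) (auto simp: dist_norm)
    finally show ?thesis .
  qed
  then obtain d u where d: "d > 0" and u0: "u 0 = y0"
    and u: "\<And>t. t \<in> {-d<..<d} \<Longrightarrow> (u has_vector_derivative ?G (u t)) (at t)"
    using picard_lipschitz [OF rL(2), of ?G y0] by blast
  have "isCont u 0" using u [of 0] d by (auto intro: has_vector_derivative_continuous)
  then obtain e where e: "e > 0" "\<And>t. \<bar>t\<bar> < e \<Longrightarrow> dist (u t) y0 < r"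
    using rL(1) u0 unfolding continuous_at_eps_delta by (auto simp: dist_real_def)
  show thesis
  proof (rule that [of "min d e" u])
    fix t assume t: "t \<in> {- min d e<..<min d e}"
    then have "\<bar>t\<bar> < e" unfolding greaterThanLessThan_iff by linarith
    then have ut: "u t \<in> ?B" using e(2) [of t] by (simp add: dist_commute)
    then show "u t \<in> S" using rL by blast
    show "(u has_vector_derivative F (u t)) (at t)"
      using u [of t] t closest_point_self [OF ut] by auto
  qed (use d e u0 in auto)
qed

text \<open>On an interval of radius \<open>\<delta>\<close> around \<open>t0\<close> with \<open>\<delta>L < 1\<close>, the maximum \<open>M\<close> of \<open>\<parallel>u - w\<parallel>\<close>
  satisfies \<open>M \<le> \<delta>LM\<close> by the mean value inequality, so it vanishes.\<close>

lemma ode_local_uniqueness: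
  fixes F :: "'a::euclidean_space \<Rightarrow> 'a"
  assumes F: "Ck_on 1 F S" and S: "open S" "u t0 \<in> S" and eq: "u t0 = w t0" and e: "e > 0"
    and u: "\<And>t. \<bar>t - t0\<bar> < e \<Longrightarrow> (u has_vector_derivative F (u t)) (at t)"
    and w: "\<And>t. \<bar>t - t0\<bar> < e \<Longrightarrow> (w has_vector_derivative F (w t)) (at t)"
  shows "\<forall>\<^sub>F t in nhds t0. u t = w t"
proof -
  obtain r L where rL: "r > 0" "L > 0"
    and lip: "\<And>x y. x \<in> cball (u t0) r \<Longrightarrow> y \<in> cball (u t0) r \<Longrightarrow> norm (F x - F y) \<le> L * norm (x - y)"
    using C1_locally_lipschitz [OF F S] by metis
  have "isCont u t0" "isCont w t0"
    using u [of t0] w [of t0] e by (auto intro: has_vector_derivative_continuous)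
  then obtain d1 d2 where d1: "d1 > 0" "\<And>t. \<bar>t - t0\<bar> < d1 \<Longrightarrow> dist (u t) (u t0) < r"
    and d2: "d2 > 0" "\<And>t. \<bar>t - t0\<bar> < d2 \<Longrightarrow> dist (w t) (w t0) < r"
    using rL(1) unfolding continuous_at_eps_delta by (metis dist_real_def)
  define d where "d = min (min d1 d2) (min e (1 / L)) / 2"
  have "0 < min (min d1 d2) (min e (1 / L))" using rL d1(1) d2(1) e by simp
  then have d: "d > 0" "d < d1" "d < d2" "d < e" "d < 1 / L"
    unfolding d_def by (simp_all, linarith+)
  then have dL: "d * L < 1" using rL by (simp add: field_simps)
  let ?I = "{t0 - d..t0 + d}"
  let ?z = "\<lambda>t. u t - w t"
  have dz: "(?z has_vector_derivative F (u t) - F (w t)) (at t)" if "t \<in> ?I" for t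
    using that d by (intro has_vector_derivative_diff u w) auto
  have "continuous_on ?I (\<lambda>t. norm (?z t))"
    using dz by (intro continuous_on_norm continuous_at_imp_continuous_on ballI)
      (rule has_vector_derivative_continuous)
  moreover have "compact ?I" "?I \<noteq> {}" using d by auto
  ultimately obtain tm where tm: "tm \<in> ?I" and M: "\<And>t. t \<in> ?I \<Longrightarrow> norm (?z t) \<le> norm (?z tm)"
    using continuous_attains_sup [of ?I "\<lambda>t. norm (?z t)"] by blast
  let ?M = "norm (?z tm)"
  have "norm (?z tm - ?z t0) \<le> (L * ?M) * norm (tm - t0)"
  proof (rule differentiable_bound [where S = ?I])
    fix t assume t: "t \<in> ?I"
    show "(?z has_derivative (\<lambda>s. s *\<^sub>R (F (u t) - F (w t)))) (at t within ?I)"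
      using dz [OF t] unfolding has_vector_derivative_def by (rule has_derivative_at_withinI)
    have "norm (F (u t) - F (w t)) \<le> L * norm (?z t)"
    proof (rule lip)
      have "\<bar>t - t0\<bar> \<le> d" using t by (auto simp: abs_le_iff)
      then show "u t \<in> cball (u t0) r" "w t \<in> cball (u t0) r"
        using d1(2) [of t] d2(2) [of t] d eq by (simp_all add: dist_commute)
    qed
    also have "\<dots> \<le> L * ?M" using M [OF t] rL by (intro mult_left_mono) auto
    finally show "onorm (\<lambda>s. s *\<^sub>R (F (u t) - F (w t))) \<le> L * ?M"
      by (intro onorm_le) (simp add: mult.commute mult_left_mono)
  qed (use tm d in auto)
  also have "\<dots> \<le> (L * ?M) * d" using tm rL by (intro mult_left_mono) auto
  finally have "?M \<le> (d * L) * ?M" by (simp add: eq mult_ac)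
  then have "?M = 0"
    using dL mult_strict_right_mono [of "d * L" 1 ?M] by (smt (verit) norm_ge_zero)
  have "u t = w t" if "dist t t0 < d" for t
  proof -
    have "t \<in> ?I" using that by (auto simp: dist_real_def abs_less_iff)
    then show ?thesis using M [of t] \<open>?M = 0\<close> by simp
  qed
  then show ?thesis using d(1) unfolding eventually_nhds_metric by blast
qed


section \<open>Charts, tangent vectors and velocities\<close>

lemma smooth_atlasD:
  assumes "smooth_atlas A" "c \<in> A"
  shows "inj_on (cmap c) (cdom c)" "open (cimg c)"
    "c' \<in> A \<Longrightarrow> open (cmap c ` (cdom c \<inter> cdom c'))"
    "c' \<in> A \<Longrightarrow> smooth_on (cmap c ` (cdom c \<inter> cdom c')) (transition c c')"
  using assms unfolding smooth_atlas_def by auto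

lemma cinv_cmap: "smooth_atlas A \<Longrightarrow> c \<in> A \<Longrightarrow> x \<in> cdom c \<Longrightarrow> cinv c (cmap c x) = x"
  unfolding cinv_def by (simp add: smooth_atlasD(1))

lemma cmap_cinv: "y \<in> cimg c \<Longrightarrow> cmap c (cinv c y) = y"
  unfolding cinv_def cimg_def by (rule f_inv_into_f)

lemma cinv_in_cdom: "y \<in> cimg c \<Longrightarrow> cinv c y \<in> cdom c"
  unfolding cinv_def cimg_def by (rule inv_into_into)

lemma cmap_in_cimg: "x \<in> cdom c \<Longrightarrow> cmap c x \<in> cimg c"
  unfolding cimg_def by (rule imageI)

lemma transition_cmap:
  "smooth_atlas A \<Longrightarrow> c \<in> A \<Longrightarrow> x \<in> cdom c \<Longrightarrow> transition c c' (cmap c x) = cmap c' x"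
  unfolding transition_def by (simp add: cinv_cmap)

lemma transition_has_derivative:
  assumes "smooth_atlas A" "c \<in> A" "c' \<in> A" "p \<in> cdom c" "p \<in> cdom c'"
  shows "(transition c c' has_derivative frechet_derivative (transition c c') (at (cmap c p))) (at (cmap c p))"
  using assms smooth_atlasD(4) [OF assms(1-3)]
  by (intro has_derivative_frechet_derivative smooth_on_imp_differentiable) auto

lemma transition_derivative_linear:
  assumes "smooth_atlas A" "c \<in> A" "c' \<in> A" "p \<in> cdom c" "p \<in> cdom c'"
  shows "linear (frechet_derivative (transition c c') (at (cmap c p)))"
  using has_derivative_linear [OF transition_has_derivative [OF assms]] .

lemma transition_derivative_self:
  assumes "smooth_atlas A" "c \<in> A" "p \<in> cdom c"
  shows "frechet_derivative (transition c c) (at (cmap c p)) u = u"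
proof -
  have "frechet_derivative (transition c c) (at (cmap c p)) = frechet_derivative (\<lambda>y. y) (at (cmap c p))"
    using smooth_atlasD(2) [OF assms(1,2)] cmap_in_cimg [OF assms(3)]
    by (rule frechet_derivative_cong_open) (simp add: transition_def cmap_cinv)
  then show ?thesis by simp
qed

lemma transition_derivative_cocycle:
  assumes "smooth_atlas A" "c \<in> A" "c' \<in> A" "c'' \<in> A" "p \<in> cdom c" "p \<in> cdom c'" "p \<in> cdom c''"
  shows "frechet_derivative (transition c' c'') (at (cmap c' p))
      (frechet_derivative (transition c c') (at (cmap c p)) u) =
    frechet_derivative (transition c c'') (at (cmap c p)) u"
proof -
  let ?D = "frechet_derivative (transition c c') (at (cmap c p))"
  let ?D' = "frechet_derivative (transition c' c'') (at (cmap c' p))"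
  have "(transition c' c'' has_derivative ?D') (at (transition c c' (cmap c p)))"
    using transition_has_derivative [OF assms(1,3,4,6,7)] transition_cmap [OF assms(1,2,5)] by simp
  then have "((\<lambda>y. transition c' c'' (transition c c' y)) has_derivative (\<lambda>u. ?D' (?D u))) (at (cmap c p))"
    using transition_has_derivative [OF assms(1,2,3,5,6)] by (rule has_derivative_compose [rotated])
  then have "(transition c c'' has_derivative (\<lambda>u. ?D' (?D u))) (at (cmap c p))"
  proof (rule has_derivative_transform_within_open)
    show "open (cmap c ` (cdom c \<inter> cdom c'))" using smooth_atlasD(3) assms(1-3) by blast
    show "transition c' c'' (transition c c' y) = transition c c'' y"
      if "y \<in> cmap c ` (cdom c \<inter> cdom c')" for y
      using that assms(1-3) by (auto simp: transition_cmap)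
  qed (use assms in auto)
  then show ?thesis by (simp add: frechet_derivative_eqI)
qed

lemma tangent_transform:
  "v \<in> tangent_space A p \<Longrightarrow> c \<in> A \<Longrightarrow> c' \<in> A \<Longrightarrow> p \<in> cdom c \<Longrightarrow> p \<in> cdom c' \<Longrightarrow>
    frechet_derivative (transition c c') (at (cmap c p)) (v c) = v c'"
  unfolding tangent_space_def mem_Collect_eq by (rule sym) blast

lemma tangent_outside:
  "v \<in> tangent_space A p \<Longrightarrow> \<not> (c \<in> A \<and> p \<in> cdom c) \<Longrightarrow> v c = 0"
  unfolding tangent_space_def mem_Collect_eq by blast

lemma tangent_spaceI:
  assumes "\<And>c. \<not> (c \<in> A \<and> p \<in> cdom c) \<Longrightarrow> v c = 0"
    and "\<And>c c'. c \<in> A \<Longrightarrow> c' \<in> A \<Longrightarrow> p \<in> cdom c \<Longrightarrow> p \<in> cdom c' \<Longrightarrow>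
      frechet_derivative (transition c c') (at (cmap c p)) (v c) = v c'"
  shows "v \<in> tangent_space A p"
  unfolding tangent_space_def mem_Collect_eq using assms by (metis IntD1 IntD2)

lemma tangent_eqI:
  assumes "v \<in> tangent_space A p" "w \<in> tangent_space A p" "c \<in> A" "p \<in> cdom c" "v c = w c"
  shows "v = w"
proof
  fix c'
  show "v c' = w c'"
  proof (cases "c' \<in> A \<and> p \<in> cdom c'")
    case True
    then show ?thesis
      using tangent_transform [OF assms(1,3)] tangent_transform [OF assms(2,3)] assms(4,5) by metis
  next
    case False
    then show ?thesis using tangent_outside assms(1,2) by metis
  qed
qed

text \<open>Prescribing a vector in one chart and transporting it by the derivatives of the transition maps
  is consistent by the chain rule.\<close>

lemma tangent_exists:
  assumes "smooth_atlas A" "c \<in> A" "p \<in> cdom c"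
  obtains v where "v \<in> tangent_space A p" "v c = u"
proof
  let ?v = "\<lambda>c'. if c' \<in> A \<and> p \<in> cdom c'
    then frechet_derivative (transition c c') (at (cmap c p)) u else 0"
  show "?v \<in> tangent_space A p"
    using assms by (intro tangent_spaceI) (auto simp: transition_derivative_cocycle)
  show "?v c = u" using assms by (simp add: transition_derivative_self)
qed

lemma tzero_in_tangent_space:
  "smooth_atlas A \<Longrightarrow> tzero \<in> tangent_space A p"
  by (intro tangent_spaceI) (simp_all add: tzero_def linear_0 [OF transition_derivative_linear])

lemma tadd_in_tangent_space:
  assumes "smooth_atlas A" "v \<in> tangent_space A p" "w \<in> tangent_space A p"
  shows "tadd v w \<in> tangent_space A p"
  using assms(2,3)
  by (intro tangent_spaceI)
    (simp_all add: tadd_def tangent_outside tangent_transform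
      linear_add [OF transition_derivative_linear [OF assms(1)]])

lemma tscale_in_tangent_space:
  assumes "smooth_atlas A" "v \<in> tangent_space A p"
  shows "tscale a v \<in> tangent_space A p"
  using assms(2)
  by (intro tangent_spaceI)
    (simp_all add: tscale_def tangent_outside tangent_transform
      linear_cmul [OF transition_derivative_linear [OF assms(1)]])

text \<open>The chart chosen in the definition of the action of a tangent vector is irrelevant, by the
  chain rule.\<close>

lemma tangent_apply_chart:
  assumes A: "smooth_atlas A" and v: "v \<in> tangent_space A p" and c: "c \<in> A" "p \<in> cdom c"
    and f: "(f \<circ> cinv c) differentiable (at (cmap c p))"
  shows "tangent_apply A p v f = frechet_derivative (f \<circ> cinv c) (at (cmap c p)) (v c)"
proof -
  define c0 where "c0 = (SOME c. c \<in> A \<and> p \<in> cdom c)"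
  have c0: "c0 \<in> A" "p \<in> cdom c0"
    using someI [of "\<lambda>c. c \<in> A \<and> p \<in> cdom c" c] c unfolding c0_def by auto
  let ?D = "frechet_derivative (f \<circ> cinv c) (at (cmap c p))"
  have "((f \<circ> cinv c) has_derivative ?D) (at (transition c0 c (cmap c0 p)))"
    using has_derivative_frechet_derivative [OF f] transition_cmap [OF A c0] by simp
  then have "((\<lambda>y. (f \<circ> cinv c) (transition c0 c y)) has_derivative
      (\<lambda>u. ?D (frechet_derivative (transition c0 c) (at (cmap c0 p)) u))) (at (cmap c0 p))"
    using transition_has_derivative [OF A c0(1) c(1) c0(2) c(2)]
    by (rule has_derivative_compose [rotated])
  then have "((f \<circ> cinv c0) has_derivative
      (\<lambda>u. ?D (frechet_derivative (transition c0 c) (at (cmap c0 p)) u))) (at (cmap c0 p))"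
  proof (rule has_derivative_transform_within_open)
    show "open (cmap c0 ` (cdom c0 \<inter> cdom c))" using smooth_atlasD(3) A c0(1) c(1) by blast
    show "(f \<circ> cinv c) (transition c0 c y) = (f \<circ> cinv c0) y"
      if "y \<in> cmap c0 ` (cdom c0 \<inter> cdom c)" for y
      using that A c0(1) c(1) by (auto simp: transition_cmap cinv_cmap)
  qed (use c c0 in auto)
  then show ?thesis
    using tangent_transform [OF v c0(1) c(1) c0(2) c(2)]
    unfolding tangent_apply_def c0_def [symmetric] Let_def by (simp add: frechet_derivative_eqI)
qed

lemma openin_mfd:
  "smooth_atlas A \<Longrightarrow>
    openin (mfd_topology A) W \<longleftrightarrow> W \<subseteq> carrier A \<and> (\<forall>c\<in>A. open (cmap c ` (W \<inter> cdom c)))"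
  by (rule openin_mfd_topology) (simp add: smooth_atlasD(1))

lemma topspace_mfd:
  assumes A: "smooth_atlas A" shows "topspace (mfd_topology A) = carrier A"
proof
  show "topspace (mfd_topology A) \<subseteq> carrier A"
    using openin_mfd [OF A] openin_topspace by blast
  have "carrier A \<inter> cdom c = cdom c" if "c \<in> A" for c using that by (auto simp: carrier_def)
  then have "openin (mfd_topology A) (carrier A)"
    using smooth_atlasD(2) [OF A] unfolding openin_mfd [OF A] cimg_def by auto
  then show "carrier A \<subseteq> topspace (mfd_topology A)" by (rule openin_subset)
qed

lemma openin_chart_preimage:
  assumes A: "smooth_atlas A" and c: "c \<in> A" and V: "open V"
  shows "openin (mfd_topology A) {x \<in> cdom c. cmap c x \<in> V}"
  unfolding openin_mfd [OF A]
proof (intro conjI ballI)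
  show "{x \<in> cdom c. cmap c x \<in> V} \<subseteq> carrier A" using c by (auto simp: carrier_def)
  fix c' assume c': "c' \<in> A"
  let ?T = "cmap c' ` (cdom c' \<inter> cdom c)"
  have "cmap c' ` ({x \<in> cdom c. cmap c x \<in> V} \<inter> cdom c') = ?T \<inter> transition c' c -` V"
    using transition_cmap [OF A c', of _ c] by (auto intro!: imageI)
  moreover have "continuous_on ?T (transition c' c)"
    using smooth_atlasD(4) [OF A c' c] unfolding smooth_on_def by (metis Ck_on.simps(1))
  moreover have "open ?T" using smooth_atlasD(3) [OF A c' c] .
  ultimately show "open (cmap c' ` ({x \<in> cdom c. cmap c x \<in> V} \<inter> cdom c'))"
    using V by (simp add: continuous_open_preimage)
qed

lemma curve_on_carrier: 
  assumes "smooth_atlas A" "curve_on A J \<gamma>" "t \<in> J" shows "\<gamma> t \<in> carrier A"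
proof -
  have "\<gamma> t \<in> topspace (mfd_topology A)"
    using assms unfolding curve_on_def continuous_map_def by auto
  then show ?thesis using topspace_mfd [OF assms(1)] by simp
qed

lemma curve_on_eventually_in_open:
  assumes "curve_on A J \<gamma>" "t \<in> J" "openin (mfd_topology A) W" "\<gamma> t \<in> W"
  shows "\<forall>\<^sub>F s in nhds t. s \<in> J \<and> \<gamma> s \<in> W"
proof -
  have "openin (top_of_set J) {s \<in> J. \<gamma> s \<in> W}"
    using assms unfolding curve_on_def continuous_map_def by simp
  then have "open {s \<in> J. \<gamma> s \<in> W}"
    using assms(1) openin_open_trans unfolding curve_on_def by blast
  then show ?thesis
    using assms(2,4) eventually_nhds_in_open [of "{s \<in> J. \<gamma> s \<in> W}" t] by simp
qed

lemma curve_on_chart: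
  assumes A: "smooth_atlas A" and \<gamma>: "curve_on A J \<gamma>" "t \<in> J" and c: "c \<in> A" "\<gamma> t \<in> cdom c"
  shows "\<forall>\<^sub>F s in nhds t. s \<in> J \<and> \<gamma> s \<in> cdom c" "isCont (cmap c \<circ> \<gamma>) t"
proof -
  show "\<forall>\<^sub>F s in nhds t. s \<in> J \<and> \<gamma> s \<in> cdom c"
    using curve_on_eventually_in_open [OF \<gamma> openin_chart_preimage [OF A c(1) open_UNIV]] c by simp
  have "\<forall>\<^sub>F s in nhds t. (cmap c \<circ> \<gamma>) s \<in> V" if "open V" "(cmap c \<circ> \<gamma>) t \<in> V" for V
    using curve_on_eventually_in_open [OF \<gamma> openin_chart_preimage [OF A c(1) that(1)]] c that(2)
    by (auto elim: eventually_mono)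
  then show "isCont (cmap c \<circ> \<gamma>) t"
    unfolding isCont_def tendsto_def by (simp add: eventually_nhds_conv_at)
qed

lemma open_if_eventually_in:
  assumes "\<And>t. t \<in> S \<Longrightarrow> \<forall>\<^sub>F s in nhds t. s \<in> S"
  shows "open S"
proof (subst open_subopen, intro ballI)
  fix t assume "t \<in> S"
  then obtain T where "open T" "t \<in> T" "\<forall>s\<in>T. s \<in> S"
    using assms [of t] unfolding eventually_nhds by blast
  then show "\<exists>T. open T \<and> t \<in> T \<and> T \<subseteq> S" by blast
qed

text \<open>Continuity into the topology induced by the atlas may be checked at each point in a single chart
  that contains the nearby part of the curve; the latter condition is not implied by the continuity
  of the chart representation, whose values outside the chart domain are arbitrary.\<close>

lemma curve_onI:
  assumes A: "smooth_atlas A" and J: "open J" "is_interval J"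
    and loc: "\<And>t. t \<in> J \<Longrightarrow> \<exists>c\<in>A. \<gamma> t \<in> cdom c \<and> (\<forall>\<^sub>F s in nhds t. \<gamma> s \<in> cdom c) \<and> isCont (cmap c \<circ> \<gamma>) t"
  shows "curve_on A J \<gamma>"
  unfolding curve_on_def continuous_map_def
proof (intro conjI J allI impI funcsetI)
  show "\<gamma> t \<in> topspace (mfd_topology A)" if "t \<in> topspace (top_of_set J)" for t
  proof -
    have t: "t \<in> J" using that by simp
    from loc [OF t] obtain c where "c \<in> A" "\<gamma> t \<in> cdom c" by blast
    then show ?thesis unfolding topspace_mfd [OF A] carrier_def by blast
  qed
  fix W assume W: "openin (mfd_topology A) W"
  have "\<forall>\<^sub>F s in nhds t. s \<in> {s \<in> J. \<gamma> s \<in> W}" if t: "t \<in> J" "\<gamma> t \<in> W" for t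
  proof -
    obtain c where c: "c \<in> A" "\<gamma> t \<in> cdom c" and ev: "\<forall>\<^sub>F s in nhds t. \<gamma> s \<in> cdom c"
      and cont: "isCont (cmap c \<circ> \<gamma>) t" using loc [OF t(1)] by blast
    let ?V = "cmap c ` (W \<inter> cdom c)"
    have "open ?V" "(cmap c \<circ> \<gamma>) t \<in> ?V" using W c t unfolding openin_mfd [OF A] by auto
    then have "\<forall>\<^sub>F s in nhds t. (cmap c \<circ> \<gamma>) s \<in> ?V"
      using cont unfolding isCont_def tendsto_def by (auto simp: eventually_nhds_conv_at)
    then have "\<forall>\<^sub>F s in nhds t. s \<in> J \<and> \<gamma> s \<in> W"
      using ev eventually_nhds_in_open [OF J(1) t(1)]
      by eventually_elim (use smooth_atlasD(1) [OF A c(1)] in \<open>auto simp: inj_on_def\<close>)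
    then show ?thesis by simp
  qed
  then have "open {s \<in> J. \<gamma> s \<in> W}" by (intro open_if_eventually_in) blast
  then show "openin (top_of_set J) {x \<in> topspace (top_of_set J). \<gamma> x \<in> W}"
    by (simp add: open_subset)
qed

lemma has_vector_derivative_eventually_cong:
  assumes "\<forall>\<^sub>F s in nhds t. f s = g s" "(f has_vector_derivative d) (at t)"
  shows "(g has_vector_derivative d) (at t)"
proof -
  obtain U where U: "open U" "t \<in> U" "\<And>s. s \<in> U \<Longrightarrow> f s = g s"
    using assms(1) unfolding eventually_nhds by blast
  show ?thesis using has_vector_derivative_transform_within_open [OF assms(2) U(1,2)] U(3) by simp
qed

lemma has_vector_derivative_frechet_compose:
  assumes "(\<tau> has_derivative D) (at (f t))" "(f has_vector_derivative d) (at t)"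
  shows "((\<lambda>s. \<tau> (f s)) has_vector_derivative D d) (at t)"
  using has_derivative_compose [OF assms(2) [unfolded has_vector_derivative_def] assms(1)]
  unfolding has_vector_derivative_def
  by (simp add: linear_cmul [OF has_derivative_linear [OF assms(1)]])

text \<open>One chart suffices to verify a velocity; the chain rule transfers it to the others.\<close>

lemma has_velocityI:
  assumes A: "smooth_atlas A" and v: "v \<in> tangent_space A (\<gamma> t)" and c: "c \<in> A" "\<gamma> t \<in> cdom c"
    and ev: "\<forall>\<^sub>F s in nhds t. \<gamma> s \<in> cdom c"
    and d: "((cmap c \<circ> \<gamma>) has_vector_derivative v c) (at t)"
  shows "has_velocity A \<gamma> t v"
  unfolding has_velocity_def
proof (intro conjI ballI impI v)
  fix c' assume c': "c' \<in> A" "\<gamma> t \<in> cdom c'"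
  have "((\<lambda>s. transition c c' ((cmap c \<circ> \<gamma>) s)) has_vector_derivative
      frechet_derivative (transition c c') (at (cmap c (\<gamma> t))) (v c)) (at t)"
    using transition_has_derivative [OF A c(1) c'(1) c(2) c'(2)]
    by (intro has_vector_derivative_frechet_compose [OF _ d]) simp
  then have "((\<lambda>s. transition c c' ((cmap c \<circ> \<gamma>) s)) has_vector_derivative v c') (at t)"
    using tangent_transform [OF v c(1) c'(1) c(2) c'(2)] by simp
  moreover have "\<forall>\<^sub>F s in nhds t. transition c c' ((cmap c \<circ> \<gamma>) s) = (cmap c' \<circ> \<gamma>) s"
    using ev by eventually_elim (simp add: transition_cmap [OF A c(1)])
  ultimately show "((cmap c' \<circ> \<gamma>) has_vector_derivative v c') (at t)"
    by (rule has_vector_derivative_eventually_cong [rotated])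
qed

lemma has_velocity_unique:
  assumes "has_velocity A \<gamma> t v" "has_velocity A \<gamma> t w" "\<gamma> t \<in> carrier A"
  shows "v = w"
proof -
  obtain c where "c \<in> A" "\<gamma> t \<in> cdom c" using assms(3) by (auto simp: carrier_def)
  then show ?thesis
    using assms(1,2) unfolding has_velocity_def
    by (blast intro: tangent_eqI vector_derivative_unique_at)
qed


section \<open>Integral curves\<close>

lemma integral_curve_exists:
  fixes A :: "('a, 'e::euclidean_space) chart set"
  assumes A: "smooth_atlas A" and X: "vector_field A X" and p: "p \<in> carrier A"
  obtains J \<gamma> where "integral_curve A X J \<gamma>" "0 \<in> J" "\<gamma> 0 = p"
proof -
  obtain c where c: "c \<in> A" "p \<in> cdom c" using p by (auto simp: carrier_def)
  let ?F = "\<lambda>y. X (cinv c y) c"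
  have F: "Ck_on 1 ?F (cimg c)" using X c(1) unfolding vector_field_def smooth_on_def by blast
  obtain d u where d: "d > 0" and u0: "u 0 = cmap c p"
    and u: "\<And>t. t \<in> {-d<..<d} \<Longrightarrow> u t \<in> cimg c"
    and du: "\<And>t. t \<in> {-d<..<d} \<Longrightarrow> (u has_vector_derivative ?F (u t)) (at t)"
    by (rule ode_local_existence [OF F smooth_atlasD(2) [OF A c(1)] cmap_in_cimg [OF c(2)]]) blast
  let ?J = "{-d<..<d}" and ?\<gamma> = "\<lambda>t. cinv c (u t)"
  have in_c: "?\<gamma> t \<in> cdom c" if "t \<in> ?J" for t using u [OF that] by (rule cinv_in_cdom)
  have ev: "\<forall>\<^sub>F s in nhds t. s \<in> ?J" if "t \<in> ?J" for t
    using that by (intro eventually_nhds_in_open) auto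
  have ev_c: "\<forall>\<^sub>F s in nhds t. ?\<gamma> s \<in> cdom c" if "t \<in> ?J" for t
    using ev [OF that] by eventually_elim (rule in_c)
  have d\<gamma>: "((cmap c \<circ> ?\<gamma>) has_vector_derivative X (?\<gamma> t) c) (at t)" if "t \<in> ?J" for t
  proof (rule has_vector_derivative_eventually_cong [OF _ du [OF that]])
    show "\<forall>\<^sub>F s in nhds t. u s = (cmap c \<circ> ?\<gamma>) s"
      using ev [OF that] by eventually_elim (simp add: cmap_cinv u)
  qed
  have "curve_on A ?J ?\<gamma>"
  proof (rule curve_onI [OF A])
    show "\<exists>c\<in>A. ?\<gamma> t \<in> cdom c \<and> (\<forall>\<^sub>F s in nhds t. ?\<gamma> s \<in> cdom c) \<and> isCont (cmap c \<circ> ?\<gamma>) t"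
      if "t \<in> ?J" for t
      using c(1) in_c [OF that] ev_c [OF that] has_vector_derivative_continuous [OF d\<gamma> [OF that]]
      by blast
  qed (auto simp: is_interval_oo)
  moreover have "has_velocity A ?\<gamma> t (X (?\<gamma> t))" if "t \<in> ?J" for t
  proof (rule has_velocityI [where \<gamma> = ?\<gamma> and t = t and c = c and v = "X (?\<gamma> t)", OF A _ c(1) in_c [OF that] ev_c [OF that] d\<gamma> [OF that]])
    show "X (?\<gamma> t) \<in> tangent_space A (?\<gamma> t)"
      using X in_c [OF that] c(1) unfolding vector_field_def carrier_def by blast
  qed
  ultimately have "integral_curve A X ?J ?\<gamma>" unfolding integral_curve_def by blast
  then show thesis using that d u0 cinv_cmap [OF A c] by auto
qed

lemma integral_curve_eventually_eq:
  assumes A: "smooth_atlas A" and X: "\<And>c. c \<in> A \<Longrightarrow> Ck_on 1 (\<lambda>y. X (cinv c y) c) (cimg c)"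
    and 1: "integral_curve A X J1 \<gamma>1" "t0 \<in> J1" and 2: "integral_curve A X J2 \<gamma>2" "t0 \<in> J2"
    and eq: "\<gamma>1 t0 = \<gamma>2 t0"
  shows "\<forall>\<^sub>F t in nhds t0. \<gamma>1 t = \<gamma>2 t"
proof -
  have C: "curve_on A J1 \<gamma>1" "curve_on A J2 \<gamma>2" using 1 2 unfolding integral_curve_def by auto
  obtain c where c: "c \<in> A" "\<gamma>1 t0 \<in> cdom c" 
    using curve_on_carrier [OF A C(1) 1(2)] unfolding carrier_def by blast
  have c2: "\<gamma>2 t0 \<in> cdom c" using c eq by simp
  let ?F = "\<lambda>y. X (cinv c y) c"
  note ev = curve_on_chart(1) [OF A C(1) 1(2) c] curve_on_chart(1) [OF A C(2) 2(2) c(1) c2]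
  obtain e where e: "e > 0"
    "\<And>t. dist t t0 < e \<Longrightarrow> (t \<in> J1 \<and> \<gamma>1 t \<in> cdom c) \<and> (t \<in> J2 \<and> \<gamma>2 t \<in> cdom c)"
    using eventually_conj [OF ev] unfolding eventually_nhds_metric by blast
  have d: "((cmap c \<circ> \<gamma>) has_vector_derivative ?F ((cmap c \<circ> \<gamma>) t)) (at t)"
    if "integral_curve A X J \<gamma>" "t \<in> J" "\<gamma> t \<in> cdom c" for J \<gamma> t
    using that c(1) cinv_cmap [OF A c(1) that(3)] unfolding integral_curve_def has_velocity_def by simp
  have "\<forall>\<^sub>F t in nhds t0. (cmap c \<circ> \<gamma>1) t = (cmap c \<circ> \<gamma>2) t"
  proof (rule ode_local_uniqueness [OF X [OF c(1)] smooth_atlasD(2) [OF A c(1)] _ _ e(1)])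
    fix t assume "\<bar>t - t0\<bar> < e"
    then have "t \<in> J1" "\<gamma>1 t \<in> cdom c" "t \<in> J2" "\<gamma>2 t \<in> cdom c"
      using e(2) [of t] by (auto simp: dist_real_def)
    then show "((cmap c \<circ> \<gamma>1) has_vector_derivative ?F ((cmap c \<circ> \<gamma>1) t)) (at t)"
      "((cmap c \<circ> \<gamma>2) has_vector_derivative ?F ((cmap c \<circ> \<gamma>2) t)) (at t)"
      using d [OF 1(1)] d [OF 2(1)] by blast+
  qed (use cmap_in_cimg [OF c(2)] eq in simp_all)
  then show ?thesis
    using ev by eventually_elim (use smooth_atlasD(1) [OF A c(1)] in \<open>auto simp: inj_on_def\<close>)
qed

text \<open>The times at which two integral curves agree form an open set by local uniqueness, and a
  closed one because the manifold is Hausdorff.\<close>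

lemma integral_curve_unique:
  assumes A: "smooth_atlas A" and H: "Hausdorff_space (mfd_topology A)"
    and X: "\<And>c. c \<in> A \<Longrightarrow> Ck_on 1 (\<lambda>y. X (cinv c y) c) (cimg c)"
    and 1: "integral_curve A X J1 \<gamma>1" "t0 \<in> J1" and 2: "integral_curve A X J2 \<gamma>2" "t0 \<in> J2"
    and eq: "\<gamma>1 t0 = \<gamma>2 t0" and t: "t \<in> J1" "t \<in> J2"
  shows "\<gamma>1 t = \<gamma>2 t"
proof -
  have C: "curve_on A J1 \<gamma>1" "curve_on A J2 \<gamma>2" using 1 2 unfolding integral_curve_def by auto
  let ?J = "J1 \<inter> J2"
  let ?E = "{s \<in> ?J. \<gamma>1 s = \<gamma>2 s}" and ?N = "{s \<in> ?J. \<gamma>1 s \<noteq> \<gamma>2 s}"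
  have oJ: "open ?J" and "is_interval ?J"
    using C unfolding curve_on_def by (auto intro: is_interval_Int)
  then have "connected ?J" by (simp add: is_interval_connected)
  have "\<forall>\<^sub>F r in nhds s. r \<in> ?E" if "s \<in> ?E" for s
    using integral_curve_eventually_eq [OF A X 1(1) _ 2(1), of s] that
      eventually_nhds_in_open [OF oJ, of s] by (auto elim: eventually_elim2)
  then have "open ?E" by (rule open_if_eventually_in)
  have "\<forall>\<^sub>F r in nhds s. r \<in> ?N" if s: "s \<in> ?N" for s
  proof -
    have "\<gamma>1 s \<in> topspace (mfd_topology A)" "\<gamma>2 s \<in> topspace (mfd_topology A)"
      using s C unfolding curve_on_def continuous_map_def by auto
    then obtain U V where UV: "openin (mfd_topology A) U" "openin (mfd_topology A) V"
      "\<gamma>1 s \<in> U" "\<gamma>2 s \<in> V" "disjnt U V"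
      using H s unfolding Hausdorff_space_def by blast
    have "\<forall>\<^sub>F r in nhds s. r \<in> J1 \<and> \<gamma>1 r \<in> U" "\<forall>\<^sub>F r in nhds s. r \<in> J2 \<and> \<gamma>2 r \<in> V"
      using curve_on_eventually_in_open [OF C(1) _ UV(1,3)]
        curve_on_eventually_in_open [OF C(2) _ UV(2,4)] s by auto
    then show ?thesis by eventually_elim (use UV(5) in \<open>auto simp: disjnt_def\<close>)
  qed
  then have "open ?N" by (rule open_if_eventually_in)
  have "?E \<inter> ?J = {} \<or> ?N \<inter> ?J = {}"
    using connectedD [OF \<open>connected ?J\<close> \<open>open ?E\<close> \<open>open ?N\<close>] by blast
  then show ?thesis using 1(2) 2(2) eq t by blast
qed


section \<open>The Lie bracket in a chart\<close>

abbreviation field_in_chart ::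
    "('a, 'e::euclidean_space) chart \<Rightarrow> ('a \<Rightarrow> ('a, 'e) tangent) \<Rightarrow> 'e \<Rightarrow> 'e" where
  "field_in_chart c X \<equiv> \<lambda>y. X (cinv c y) c"

text \<open>The regularity at which the coordinate formula for the bracket makes sense; the first bracket
  enters the second one through it.\<close>

definition differentiable_field ::
    "('a, 'e::euclidean_space) chart set \<Rightarrow> ('a \<Rightarrow> ('a, 'e) tangent) \<Rightarrow> bool" where
  "differentiable_field A X \<longleftrightarrow>
     (\<forall>p\<in>carrier A. X p \<in> tangent_space A p) \<and>
     (\<forall>c\<in>A. \<forall>y\<in>cimg c. field_in_chart c X differentiable (at y))"

lemma vector_field_imp_differentiable_field:
  "vector_field A X \<Longrightarrow> differentiable_field A X"
  unfolding vector_field_def differentiable_field_def by (blast intro: smooth_on_imp_differentiable)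

definition bracket_in_chart ::
    "('a, 'e::euclidean_space) chart \<Rightarrow> ('a \<Rightarrow> ('a, 'e) tangent) \<Rightarrow> ('a \<Rightarrow> ('a, 'e) tangent)
      \<Rightarrow> 'a \<Rightarrow> 'e" where
  "bracket_in_chart c X Y p =
     frechet_derivative (field_in_chart c Y) (at (cmap c p)) (X p c) -
     frechet_derivative (field_in_chart c X) (at (cmap c p)) (Y p c)"

text \<open>The inner derivation acts on germs: on a whole neighbourhood of \<open>p\<close> the function \<open>Y f\<close> is
  \<open>DF \<cdot> Y\<close> in the chart, where \<open>F\<close> represents \<open>f\<close>, so the outer derivation may be computed from it.\<close>

lemma tangent_apply_field:
  assumes A: "smooth_atlas A" and X: "X p \<in> tangent_space A p" and Y: "differentiable_field A Y"
    and c: "c \<in> A" "p \<in> cdom c"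
    and U: "openin (mfd_topology A) U" "p \<in> U" and f: "smooth_fun_on A U f"
  shows "tangent_apply A p (X p) (\<lambda>q. tangent_apply A q (Y q) f) =
    frechet_derivative (\<lambda>y. frechet_derivative (f \<circ> cinv c) (at y) (field_in_chart c Y y))
      (at (cmap c p)) (X p c)"
proof -
  let ?S = "cmap c ` (U \<inter> cdom c)" and ?F = "f \<circ> cinv c" and ?Y = "field_in_chart c Y"
  have S: "open ?S" "cmap c p \<in> ?S" using U c openin_mfd [OF A] by auto
  have F: "smooth_on ?S ?F" using f c(1) unfolding smooth_fun_on_def by blast
  have eq: "((\<lambda>q. tangent_apply A q (Y q) f) \<circ> cinv c) y = frechet_derivative ?F (at y) (?Y y)"
    if "y \<in> ?S" for y
  proof -
    obtain q where q: "q \<in> U" "q \<in> cdom c" "y = cmap c q" using \<open>y \<in> ?S\<close> by blast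
    have "Y q \<in> tangent_space A q"
      using Y q(2) c(1) unfolding differentiable_field_def carrier_def by blast
    then show ?thesis
      using tangent_apply_chart [OF A _ c(1) q(2), of "Y q" f] smooth_on_imp_differentiable [OF F that]
        q(3) cinv_cmap [OF A c(1) q(2)] by simp
  qed
  have "((\<lambda>y. frechet_derivative ?F (at y) (?Y y)) has_derivative
      (\<lambda>h. frechet_derivative (\<lambda>y. frechet_derivative ?F (at y) (?Y (cmap c p))) (at (cmap c p)) h +
        frechet_derivative ?F (at (cmap c p)) (frechet_derivative ?Y (at (cmap c p)) h))) (at (cmap c p))"
    using F Y c(1) cmap_in_cimg [OF c(2)] S unfolding smooth_on_def differentiable_field_def
    by (intro derivative_of_directional_derivative [where S = ?S]) auto
  then have "(\<lambda>y. frechet_derivative ?F (at y) (?Y y)) differentiable (at (cmap c p))"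
    unfolding differentiable_def by blast
  then have "((\<lambda>q. tangent_apply A q (Y q) f) \<circ> cinv c) differentiable (at (cmap c p))"
    by (rule differentiable_cong_open [OF S, rotated]) (rule eq [symmetric])
  then have "tangent_apply A p (X p) (\<lambda>q. tangent_apply A q (Y q) f) =
      frechet_derivative ((\<lambda>q. tangent_apply A q (Y q) f) \<circ> cinv c) (at (cmap c p)) (X p c)"
    by (rule tangent_apply_chart [OF A X c])
  also have "\<dots> = frechet_derivative (\<lambda>y. frechet_derivative ?F (at y) (?Y y)) (at (cmap c p)) (X p c)"
    by (rule arg_cong [where f = "\<lambda>D. D (X p c)"], rule frechet_derivative_cong_open [OF S eq])
  finally show ?thesis .
qed

lemma commutator_of_fields:
  assumes A: "smooth_atlas A" and X: "differentiable_field A X" and Y: "differentiable_field A Y"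
    and c: "c \<in> A" "p \<in> cdom c"
    and U: "openin (mfd_topology A) U" "p \<in> U" and f: "smooth_fun_on A U f"
  shows "tangent_apply A p (X p) (\<lambda>q. tangent_apply A q (Y q) f) -
      tangent_apply A p (Y p) (\<lambda>q. tangent_apply A q (X q) f) =
    frechet_derivative (f \<circ> cinv c) (at (cmap c p)) (bracket_in_chart c X Y p)"
proof -
  let ?S = "cmap c ` (U \<inter> cdom c)"
  have "X p \<in> tangent_space A p" "Y p \<in> tangent_space A p"
    using X Y c unfolding differentiable_field_def carrier_def by blast+
  note acts = tangent_apply_field [where X = X and p = p, OF A this(1) Y c U f]
    tangent_apply_field [where X = Y and p = p, OF A this(2) X c U f]
  have "Ck_on 2 (f \<circ> cinv c) ?S"
    using f c(1) unfolding smooth_fun_on_def smooth_on_def by blast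
  moreover have "open ?S" "cmap c p \<in> ?S" using U c openin_mfd [OF A] by auto
  moreover have "field_in_chart c X differentiable (at (cmap c p))"
    "field_in_chart c Y differentiable (at (cmap c p))"
    using X Y c cmap_in_cimg [OF c(2)] unfolding differentiable_field_def by blast+
  ultimately show ?thesis
    using commutator_of_directional_derivatives [of "f \<circ> cinv c" ?S "cmap c p"
        "field_in_chart c X" "field_in_chart c Y"]
    unfolding acts bracket_in_chart_def cinv_cmap [OF A c] by simp
qed

lemma smooth_chart_component:
  fixes A :: "('a, 'e::euclidean_space) chart set"
  assumes A: "smooth_atlas A" and c: "c \<in> A"
  shows "smooth_fun_on A (cdom c) (\<lambda>x. cmap c x \<bullet> b)"
  unfolding smooth_fun_on_def
proof
  fix c' assume c': "c' \<in> A"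
  have "(\<lambda>x. cmap c x \<bullet> b) \<circ> cinv c' = (\<lambda>y. transition c' c y \<bullet> b)"
    by (auto simp: transition_def)
  then show "smooth_on (cmap c' ` (cdom c \<inter> cdom c')) ((\<lambda>x. cmap c x \<bullet> b) \<circ> cinv c')"
    using smooth_atlasD(3,4) [OF A c' c]
    by (simp add: Int_commute smooth_on_def Ck_on_linear_compose [OF bounded_linear_inner_left])
qed

text \<open>The vector with the components of the chart formula represents the commutator, and it is the only
  one: the coordinate functions of a chart are admissible test functions and detect every component.\<close>

theorem lie_bracket_in_chart:
  assumes A: "smooth_atlas A" and X: "differentiable_field A X" and Y: "differentiable_field A Y"
    and p: "p \<in> carrier A"
  shows "lie_bracket A X Y p \<in> tangent_space A p"
    and "\<And>c. c \<in> A \<Longrightarrow> p \<in> cdom c \<Longrightarrow> lie_bracket A X Y p c = bracket_in_chart c X Y p"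
proof -
  let ?Q = "\<lambda>z. z \<in> tangent_space A p \<and>
     (\<forall>U f. openin (mfd_topology A) U \<and> p \<in> U \<and> smooth_fun_on A U f \<longrightarrow>
        tangent_apply A p z f =
          tangent_apply A p (X p) (\<lambda>q. tangent_apply A q (Y q) f) -
          tangent_apply A p (Y p) (\<lambda>q. tangent_apply A q (X q) f))"
  have coord: "z c = bracket_in_chart c X Y p" if z: "?Q z" and c: "c \<in> A" "p \<in> cdom c" for z c
  proof (rule euclidean_eqI)
    fix b :: 'b assume "b \<in> Basis"
    let ?f = "\<lambda>x. cmap c x \<bullet> b"
    have U: "openin (mfd_topology A) (cdom c)"
      using openin_chart_preimage [OF A c(1) open_UNIV] by simp
    have "((\<lambda>y. y \<bullet> b) has_derivative (\<lambda>u. u \<bullet> b)) (at (cmap c p))"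
      by (auto intro!: derivative_eq_intros)
    then have d: "((?f \<circ> cinv c) has_derivative (\<lambda>u. u \<bullet> b)) (at (cmap c p))"
      by (rule has_derivative_transform_within_open
          [OF _ smooth_atlasD(2) [OF A c(1)] cmap_in_cimg [OF c(2)]]) (simp add: cmap_cinv)
    then have "?f \<circ> cinv c differentiable (at (cmap c p))" unfolding differentiable_def by blast
    then have "tangent_apply A p z ?f = frechet_derivative (?f \<circ> cinv c) (at (cmap c p)) (z c)"
      using z by (intro tangent_apply_chart [OF A _ c]) auto
    then have "z c \<bullet> b = tangent_apply A p z ?f" by (simp add: frechet_derivative_eqI [OF d])
    also have "\<dots> = tangent_apply A p (X p) (\<lambda>q. tangent_apply A q (Y q) ?f) -
        tangent_apply A p (Y p) (\<lambda>q. tangent_apply A q (X q) ?f)"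
      using z U c(2) smooth_chart_component [OF A c(1), of b] by blast
    also have "\<dots> = frechet_derivative (?f \<circ> cinv c) (at (cmap c p)) (bracket_in_chart c X Y p)"
      by (rule commutator_of_fields [OF A X Y c U c(2) smooth_chart_component [OF A c(1)]])
    finally show "z c \<bullet> b = bracket_in_chart c X Y p \<bullet> b"
      by (simp add: frechet_derivative_eqI [OF d])
  qed
  obtain c where c: "c \<in> A" "p \<in> cdom c" using p by (auto simp: carrier_def)
  obtain z where z: "z \<in> tangent_space A p" "z c = bracket_in_chart c X Y p"
    using tangent_exists [OF A c] .
  have Qz: "?Q z"
  proof (intro conjI z allI impI; elim conjE)
    fix U f assume U: "openin (mfd_topology A) U" "p \<in> U" and f: "smooth_fun_on A U f"
    have "smooth_on (cmap c ` (U \<inter> cdom c)) (f \<circ> cinv c)"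
      using f c(1) unfolding smooth_fun_on_def by blast
    then have "f \<circ> cinv c differentiable (at (cmap c p))"
      using U(2) c(2) by (intro smooth_on_imp_differentiable) auto
    then show "tangent_apply A p z f = tangent_apply A p (X p) (\<lambda>q. tangent_apply A q (Y q) f) -
          tangent_apply A p (Y p) (\<lambda>q. tangent_apply A q (X q) f)"
      unfolding commutator_of_fields [OF A X Y c U f] using z
      by (simp add: tangent_apply_chart [OF A z(1) c])
  qed
  have uniq: "z' = z" if "?Q z'" for z'
  proof (rule tangent_eqI [OF _ z(1) c])
    show "z' c = z c" using coord [OF that c] z(2) by simp
  qed (use that in blast)
  have eq: "lie_bracket A X Y p = z" unfolding lie_bracket_def using Qz uniq by (rule the_equality)
  have bracket: "?Q (lie_bracket A X Y p)" unfolding eq by (rule Qz)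
  then show "lie_bracket A X Y p \<in> tangent_space A p" by blast
  show "lie_bracket A X Y p c = bracket_in_chart c X Y p" if "c \<in> A" "p \<in> cdom c" for c
    using coord [OF bracket that] .
qed


section \<open>The manifold \<open>TM \<oplus> TM\<close>\<close>

lemma cdom_sum_chart:
  "(x, V, R) \<in> cdom (sum_chart A c) \<longleftrightarrow>
     x \<in> cdom c \<and> V \<in> tangent_space A x \<and> R \<in> tangent_space A x"
  by (simp add: cdom_def sum_chart_def)

lemma cmap_sum_chart: "cmap (sum_chart A c) (x, V, R) = (cmap c x, V c, R c)"
  by (simp add: cmap_def sum_chart_def)

text \<open>Every triple of coordinates comes from a point, because a tangent vector may be prescribed
  in one chart.\<close>

lemma sum_chart_image:
  assumes A: "smooth_atlas A" and c: "c \<in> A" and U: "U \<subseteq> cdom c"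
  shows "cmap (sum_chart A c) ` {(x, V, R). x \<in> U \<and> V \<in> tangent_space A x \<and> R \<in> tangent_space A x} =
    cmap c ` U \<times> UNIV"
proof (intro equalityI subsetI)
  fix z assume "z \<in> cmap c ` U \<times> (UNIV :: ('b \<times> 'b) set)"
  then obtain x v r where z: "z = (cmap c x, v, r)" "x \<in> U" by (cases z) auto
  then have "x \<in> cdom c" using U by blast
  obtain V where V: "V \<in> tangent_space A x" "V c = v" using tangent_exists [OF A c \<open>x \<in> cdom c\<close>] .
  obtain R where R: "R \<in> tangent_space A x" "R c = r" using tangent_exists [OF A c \<open>x \<in> cdom c\<close>] .
  show "z \<in> cmap (sum_chart A c) ` {(x, V, R). x \<in> U \<and> V \<in> tangent_space A x \<and> R \<in> tangent_space A x}"
    using z V R by (intro image_eqI [where x = "(x, V, R)"]) (simp_all add: cmap_sum_chart)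
qed (auto simp: cmap_sum_chart)

lemma cimg_sum_chart:
  "smooth_atlas A \<Longrightarrow> c \<in> A \<Longrightarrow> cimg (sum_chart A c) = cimg c \<times> UNIV"
  using sum_chart_image [of A c "cdom c"] unfolding cimg_def [of c]
  by (simp add: cimg_def cdom_def sum_chart_def)

lemma inj_on_sum_chart:
  assumes A: "smooth_atlas A" and c: "c \<in> A"
  shows "inj_on (cmap (sum_chart A c)) (cdom (sum_chart A c))"
proof (rule inj_onI)
  fix p q assume p: "p \<in> cdom (sum_chart A c)" and q: "q \<in> cdom (sum_chart A c)"
    and eq: "cmap (sum_chart A c) p = cmap (sum_chart A c) q"
  obtain x V R x' V' R' where pq: "p = (x, V, R)" "q = (x', V', R')" by (metis prod_cases3)
  have "x = x'"
    using eq p q smooth_atlasD(1) [OF A c] unfolding pq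
    by (auto simp: cmap_sum_chart cdom_sum_chart inj_on_def)
  then show "p = q"
    using eq p q tangent_eqI [OF _ _ c, of _ x] unfolding pq
    by (auto simp: cmap_sum_chart cdom_sum_chart)
qed

lemma sum_chart_overlap:
  assumes "smooth_atlas A" "c \<in> A"
  shows "cmap (sum_chart A c) ` (cdom (sum_chart A c) \<inter> cdom (sum_chart A c')) =
    cmap c ` (cdom c \<inter> cdom c') \<times> UNIV"
proof -
  have "cdom (sum_chart A c) \<inter> cdom (sum_chart A c') =
    {(x, V, R). x \<in> cdom c \<inter> cdom c' \<and> V \<in> tangent_space A x \<and> R \<in> tangent_space A x}"
    by (auto simp: cdom_sum_chart)
  then show ?thesis using sum_chart_image [OF assms, of "cdom c \<inter> cdom c'"] by simp
qed

lemma transition_sum_chart: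
  assumes A: "smooth_atlas A" and c: "c \<in> A" "c' \<in> A" and y: "y \<in> cmap c ` (cdom c \<inter> cdom c')"
  shows "transition (sum_chart A c) (sum_chart A c') (y, v, r) =
    (transition c c' y, frechet_derivative (transition c c') (at y) v,
      frechet_derivative (transition c c') (at y) r)"
proof -
  obtain x where x: "x \<in> cdom c" "x \<in> cdom c'" "y = cmap c x" using y by blast
  obtain V where V: "V \<in> tangent_space A x" "V c = v" using tangent_exists [OF A c(1) x(1)] .
  obtain R where R: "R \<in> tangent_space A x" "R c = r" using tangent_exists [OF A c(1) x(1)] .
  have "cinv (sum_chart A c) (y, v, r) = (x, V, R)"
    using inv_into_f_f [OF inj_on_sum_chart [OF A c(1)], of "(x, V, R)"] x V R
    by (simp add: cinv_def cdom_sum_chart cmap_sum_chart)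
  then show ?thesis
    using tangent_transform [OF V(1) c x(1,2)] tangent_transform [OF R(1) c x(1,2)] x V R
    by (simp add: transition_def [of "sum_chart A c"] cmap_sum_chart transition_cmap [OF A c(1)])
qed

lemma smooth_atlas_sum_atlas:
  fixes A :: "('a, 'e::euclidean_space) chart set"
  assumes A: "smooth_atlas A"
  shows "smooth_atlas (sum_atlas A)"
proof -
  have "smooth_on (cmap c ` (cdom c \<inter> cdom c') \<times> UNIV) (transition (sum_chart A c) (sum_chart A c'))"
    if c: "c \<in> A" "c' \<in> A" for c c'
  proof -
    let ?S = "cmap c ` (cdom c \<inter> cdom c')" and ?\<tau> = "transition c c'"
    have S: "open ?S" and \<tau>: "smooth_on ?S ?\<tau>" using smooth_atlasD(3,4) [OF A c] by auto
    have oS: "open (?S \<times> (UNIV :: ('e \<times> 'e) set))" using S by (simp add: open_Times)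
    note lin = bounded_linear_fst bounded_linear_fst_comp [OF bounded_linear_snd]
      bounded_linear_snd_comp [OF bounded_linear_snd]
    have "smooth_on (?S \<times> UNIV) (\<lambda>z::'e \<times> 'e \<times> 'e. (?\<tau> (fst z),
      frechet_derivative ?\<tau> (at (fst z)) (fst (snd z)), frechet_derivative ?\<tau> (at (fst z)) (snd (snd z))))"
      unfolding smooth_on_def
    proof (intro allI Ck_on_Pair oS)
      fix k
      show "Ck_on k (\<lambda>z::'e \<times> 'e \<times> 'e. ?\<tau> (fst z)) (?S \<times> UNIV)"
        using \<tau> unfolding smooth_on_def by (intro Ck_on_compose_linear [OF lin(1) oS, where T = ?S]) auto
      show "Ck_on k (\<lambda>z::'e \<times> 'e \<times> 'e. frechet_derivative ?\<tau> (at (fst z)) (fst (snd z))) (?S \<times> UNIV)"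
        "Ck_on k (\<lambda>z::'e \<times> 'e \<times> 'e. frechet_derivative ?\<tau> (at (fst z)) (snd (snd z))) (?S \<times> UNIV)"
        using smooth_on_frechet_derivative_apply [OF \<tau> oS lin(1,2)]
          smooth_on_frechet_derivative_apply [OF \<tau> oS lin(1,3)]
        unfolding smooth_on_def by auto
    qed
    then show ?thesis
      by (rule smooth_on_cong [OF oS, rotated]) (auto simp: transition_sum_chart [OF A c])
  qed
  moreover have "open (cmap c ` (cdom c \<inter> cdom c') \<times> (UNIV :: ('e \<times> 'e) set))"
    if "c \<in> A" "c' \<in> A" for c c'
    using smooth_atlasD(3) [OF A that] by (simp add: open_Times)
  moreover have "open (cimg c \<times> (UNIV :: ('e \<times> 'e) set))" if "c \<in> A" for c
    using smooth_atlasD(2) [OF A that] by (simp add: open_Times)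
  ultimately show ?thesis
    unfolding smooth_atlas_def sum_atlas_def
    by (simp add: inj_on_sum_chart [OF A] cimg_sum_chart [OF A] sum_chart_overlap [OF A])
qed

lemma openin_sum_preimage:
  assumes A: "smooth_atlas A" and U: "openin (mfd_topology A) U"
  shows "openin (mfd_topology (sum_atlas A))
    {(x, V, R). x \<in> U \<and> V \<in> tangent_space A x \<and> R \<in> tangent_space A x}"
    (is "openin _ ?W")
  unfolding openin_mfd [OF smooth_atlas_sum_atlas [OF A]]
proof (intro conjI ballI)
  show "?W \<subseteq> carrier (sum_atlas A)"
    using U unfolding openin_mfd [OF A] carrier_sum_atlas by auto
  fix C assume "C \<in> sum_atlas A"
  then obtain c where c: "c \<in> A" "C = sum_chart A c" unfolding sum_atlas_def by blast
  have "?W \<inter> cdom C = {(x, V, R). x \<in> U \<inter> cdom c \<and> V \<in> tangent_space A x \<and> R \<in> tangent_space A x}"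
    by (auto simp: c(2) cdom_sum_chart)
  then have "cmap C ` (?W \<inter> cdom C) = cmap c ` (U \<inter> cdom c) \<times> UNIV"
    using sum_chart_image [OF A c(1), of "U \<inter> cdom c"] c(2) by simp
  then show "open (cmap C ` (?W \<inter> cdom C))"
    using U c(1) unfolding openin_mfd [OF A] by (simp add: open_Times)
qed

lemma Hausdorff_sum_atlas:
  assumes A: "smooth_atlas A" and H: "Hausdorff_space (mfd_topology A)"
  shows "Hausdorff_space (mfd_topology (sum_atlas A))"
  unfolding Hausdorff_space_def
proof (intro allI impI, elim conjE)
  fix p q assume pq: "p \<in> topspace (mfd_topology (sum_atlas A))"
    "q \<in> topspace (mfd_topology (sum_atlas A))" "p \<noteq> q"
  note S = smooth_atlas_sum_atlas [OF A]
  have car: "p \<in> carrier (sum_atlas A)" "q \<in> carrier (sum_atlas A)"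
    using pq(1,2) topspace_mfd [OF S] by simp_all
  obtain x V R x' V' R' where eq: "p = (x, V, R)" "q = (x', V', R')" by (metis prod_cases3)
  have mem: "x \<in> carrier A" "V \<in> tangent_space A x" "R \<in> tangent_space A x"
    "x' \<in> carrier A" "V' \<in> tangent_space A x'" "R' \<in> tangent_space A x'"
    using car unfolding eq carrier_sum_atlas by auto
  show "\<exists>U W. openin (mfd_topology (sum_atlas A)) U \<and> openin (mfd_topology (sum_atlas A)) W \<and>
      p \<in> U \<and> q \<in> W \<and> disjnt U W"
  proof (cases "x = x'")
    case False
    have "x \<in> topspace (mfd_topology A)" "x' \<in> topspace (mfd_topology A)"
      using mem topspace_mfd [OF A] by simp_all
    then obtain U U' where U: "openin (mfd_topology A) U" "openin (mfd_topology A) U'"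
      "x \<in> U" "x' \<in> U'" "disjnt U U'"
      using H False unfolding Hausdorff_space_def by blast
    let ?W = "\<lambda>U. {(x, V, R). x \<in> U \<and> V \<in> tangent_space A x \<and> R \<in> tangent_space A x}"
    have "openin (mfd_topology (sum_atlas A)) (?W U)" "openin (mfd_topology (sum_atlas A)) (?W U')"
      using openin_sum_preimage [OF A] U(1,2) by blast+
    moreover have "p \<in> ?W U" "q \<in> ?W U'" using U mem by (auto simp: eq)
    moreover have "disjnt (?W U) (?W U')" using U(5) by (auto simp: disjnt_def)
    ultimately show ?thesis by blast
  next
    case True
    obtain c where c: "c \<in> A" "x \<in> cdom c" using mem(1) unfolding carrier_def by blast
    let ?C = "sum_chart A c"
    have C: "?C \<in> sum_atlas A" "p \<in> cdom ?C" "q \<in> cdom ?C"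
      using c mem True by (auto simp: sum_atlas_def eq cdom_sum_chart)
    then have "cmap ?C p \<noteq> cmap ?C q"
      using pq(3) inj_onD [OF inj_on_sum_chart [OF A c(1)]] by blast
    from hausdorff [OF this]
    obtain U W where UW: "open U" "open W" "cmap ?C p \<in> U" "cmap ?C q \<in> W" "U \<inter> W = {}"
      by blast
    show ?thesis
      using openin_chart_preimage [OF S C(1) UW(1)] openin_chart_preimage [OF S C(1) UW(2)] C UW
      by (intro exI [of _ "{z \<in> cdom ?C. cmap ?C z \<in> U}"] exI [of _ "{z \<in> cdom ?C. cmap ?C z \<in> W}"])
        (auto simp: disjnt_def)
  qed
qed

lemma sum_curve_on:
  assumes A: "smooth_atlas A" and J: "open J" "is_interval J"
    and car: "\<And>t. t \<in> J \<Longrightarrow> V t \<in> tangent_space A (x t) \<and> R t \<in> tangent_space A (x t)"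
    and x: "curve_on A J x"
    and cont: "\<And>t c. t \<in> J \<Longrightarrow> c \<in> A \<Longrightarrow> x t \<in> cdom c \<Longrightarrow> isCont (\<lambda>s. V s c) t \<and> isCont (\<lambda>s. R s c) t"
  shows "curve_on (sum_atlas A) J (\<lambda>t. (x t, V t, R t))"
proof (rule curve_onI [OF smooth_atlas_sum_atlas [OF A] J])
  fix t assume t: "t \<in> J"
  obtain c where c: "c \<in> A" "x t \<in> cdom c"
    using curve_on_carrier [OF A x t] unfolding carrier_def by blast
  let ?C = "sum_chart A c" and ?\<gamma> = "\<lambda>t. (x t, V t, R t)"
  have "?\<gamma> t \<in> cdom ?C" using c(2) car [OF t] by (simp add: cdom_sum_chart)
  moreover have "\<forall>\<^sub>F s in nhds t. ?\<gamma> s \<in> cdom ?C"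
    using curve_on_chart(1) [OF A x t c] by eventually_elim (simp add: cdom_sum_chart car)
  moreover have "cmap ?C \<circ> ?\<gamma> = (\<lambda>s. ((cmap c \<circ> x) s, V s c, R s c))"
    by (auto simp: cmap_sum_chart)
  moreover have "isCont (\<lambda>s. ((cmap c \<circ> x) s, V s c, R s c)) t"
    using curve_on_chart(2) [OF A x t c] cont [OF t c] by (intro isCont_Pair) (auto simp: o_def)
  ultimately show "\<exists>C\<in>sum_atlas A. ?\<gamma> t \<in> cdom C \<and> (\<forall>\<^sub>F s in nhds t. ?\<gamma> s \<in> cdom C) \<and> isCont (cmap C \<circ> ?\<gamma>) t"
    using c(1) by (intro bexI [of _ ?C]) (auto simp: sum_atlas_def)
qed

lemma sum_curve_onD:
  assumes A: "smooth_atlas A" and \<gamma>: "curve_on (sum_atlas A) J (\<lambda>t. (x t, V t, R t))"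
  shows "curve_on A J x"
    "t \<in> J \<Longrightarrow> x t \<in> carrier A \<and> V t \<in> tangent_space A (x t) \<and> R t \<in> tangent_space A (x t)"
    "t \<in> J \<Longrightarrow> c \<in> A \<Longrightarrow> x t \<in> cdom c \<Longrightarrow> isCont (\<lambda>s. V s c) t \<and> isCont (\<lambda>s. R s c) t"
proof -
  note S = smooth_atlas_sum_atlas [OF A]
  show car: "x t \<in> carrier A \<and> V t \<in> tangent_space A (x t) \<and> R t \<in> tangent_space A (x t)"
    if "t \<in> J" for t
    using curve_on_carrier [OF S \<gamma> that] unfolding carrier_sum_atlas by simp
  let ?\<gamma> = "\<lambda>t. (x t, V t, R t)"
  have chart: "sum_chart A c \<in> sum_atlas A" "?\<gamma> t \<in> cdom (sum_chart A c)"
    if "t \<in> J" "c \<in> A" "x t \<in> cdom c" for t c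
    using car [OF that(1)] that by (auto simp: sum_atlas_def cdom_sum_chart)
  have cont: "isCont (\<lambda>s. (cmap c (x s), V s c, R s c)) t" if "t \<in> J" "c \<in> A" "x t \<in> cdom c" for t c
    using curve_on_chart(2) [OF S \<gamma> that(1) chart [OF that]] by (simp add: o_def cmap_sum_chart)
  show "isCont (\<lambda>s. V s c) t \<and> isCont (\<lambda>s. R s c) t" if "t \<in> J" "c \<in> A" "x t \<in> cdom c" for t c
    using isCont_fst [OF isCont_snd [OF cont [OF that]]] isCont_snd [OF isCont_snd [OF cont [OF that]]]
    by simp
  show "curve_on A J x"
  proof (rule curve_onI [OF A])
    fix t assume t: "t \<in> J"
    then obtain c where c: "c \<in> A" "x t \<in> cdom c" using car unfolding carrier_def by blast
    have "\<forall>\<^sub>F s in nhds t. x s \<in> cdom c"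
      using curve_on_chart(1) [OF S \<gamma> t chart [OF t c]] by eventually_elim (simp add: cdom_sum_chart)
    moreover have "isCont (cmap c \<circ> x) t"
      using isCont_fst [OF cont [OF t c]] by (simp add: o_def)
    ultimately show "\<exists>c\<in>A. x t \<in> cdom c \<and> (\<forall>\<^sub>F s in nhds t. x s \<in> cdom c) \<and> isCont (cmap c \<circ> x) t"
      using c by blast
  qed (use \<gamma> in \<open>auto simp: curve_on_def\<close>)
qed

lemma has_vector_derivative_Pair_iff:
  "((\<lambda>s. (f s, g s)) has_vector_derivative (a, b)) (at t) \<longleftrightarrow>
    (f has_vector_derivative a) (at t) \<and> (g has_vector_derivative b) (at t)"
proof
  assume d: "((\<lambda>s. (f s, g s)) has_vector_derivative (a, b)) (at t)"
  show "(f has_vector_derivative a) (at t) \<and> (g has_vector_derivative b) (at t)"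
    using bounded_linear.has_vector_derivative [OF bounded_linear_fst d]
      bounded_linear.has_vector_derivative [OF bounded_linear_snd d] by simp
qed (auto intro: has_vector_derivative_Pair)

lemma sum_velocity_iff:
  assumes A: "smooth_atlas A" and \<gamma>: "curve_on (sum_atlas A) J (\<lambda>t. (x t, V t, R t))" and t: "t \<in> J"
    and v: "v \<in> tangent_space (sum_atlas A) (x t, V t, R t)"
  shows "has_velocity (sum_atlas A) (\<lambda>t. (x t, V t, R t)) t v \<longleftrightarrow>
    (\<forall>c\<in>A. x t \<in> cdom c \<longrightarrow>
      ((cmap c \<circ> x) has_vector_derivative fst (v (sum_chart A c))) (at t) \<and>
      ((\<lambda>s. V s c) has_vector_derivative fst (snd (v (sum_chart A c)))) (at t) \<and>
      ((\<lambda>s. R s c) has_vector_derivative snd (snd (v (sum_chart A c)))) (at t))"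
proof -
  have eq: "cmap (sum_chart A c) \<circ> (\<lambda>t. (x t, V t, R t)) = (\<lambda>s. ((cmap c \<circ> x) s, V s c, R s c))" for c
    by (auto simp: cmap_sum_chart)
  have "((\<lambda>s. ((cmap c \<circ> x) s, V s c, R s c)) has_vector_derivative w) (at t) \<longleftrightarrow>
      ((cmap c \<circ> x) has_vector_derivative fst w) (at t) \<and>
      ((\<lambda>s. V s c) has_vector_derivative fst (snd w)) (at t) \<and>
      ((\<lambda>s. R s c) has_vector_derivative snd (snd w)) (at t)" for c w
    by (cases w) (simp add: has_vector_derivative_Pair_iff del: o_apply)
  then show ?thesis
    using v sum_curve_onD(2) [OF A \<gamma> t]
    unfolding has_velocity_def sum_atlas_def by (simp add: eq cdom_sum_chart)
qed


section \<open>The Levi-Civita connection in a chart\<close>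

text \<open>Nondegeneracy gives \<open>L = G b\<close>: the map \<open>b \<mapsto> \<Sum>\<^sub>i G b e\<^sub>i e\<^sub>i\<close> is injective, hence surjective.\<close>

lemma riesz_representation:
  fixes G :: "'e::euclidean_space \<Rightarrow> 'e \<Rightarrow> real"
  assumes G: "bilinear G" and pos: "\<And>u. u \<noteq> 0 \<Longrightarrow> G u u > 0" and L: "linear L"
  obtains b where "\<And>w. G b w = L w"
proof -
  have lin2: "linear (G u)" and lin1: "linear (\<lambda>u. G u w)" for u w
    using G unfolding bilinear_def by auto
  let ?P = "\<lambda>b. \<Sum>i\<in>Basis. G b i *\<^sub>R i"
  have comp: "?P b \<bullet> i = G b i" if "i \<in> Basis" for b i using that by simp
  have "linear ?P"
    by (rule linearI)
      (simp_all add: linear_add [OF lin1] linear_cmul [OF lin1] scaleR_left_distrib sum.distrib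
        scaleR_sum_right)
  moreover have "inj ?P"
    unfolding linear_injective_0 [OF \<open>linear ?P\<close>]
  proof (intro allI impI)
    fix b assume "?P b = 0"
    then have "G b i = 0" if "i \<in> Basis" for i using comp [OF that, of b] by simp
    then have "G b b = 0" by (subst linear_eq_sum_Basis [OF lin2]) simp
    then show "b = 0" using pos [of b] by fastforce
  qed
  ultimately have "surj ?P" by (simp add: linear_injective_imp_surjective)
  then obtain b where "(\<Sum>i\<in>Basis. L i *\<^sub>R i) = ?P b" by (rule surjE)
  then have b: "?P b = (\<Sum>i\<in>Basis. L i *\<^sub>R i)" by (rule sym)
  have "G b i = L i" if "i \<in> Basis" for i using comp [OF that, of b] that by (simp add: b)
  then have "G b w = L w" for w
    by (subst linear_eq_sum_Basis [OF lin2], subst linear_eq_sum_Basis [OF L]) simp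
  then show thesis using that by blast
qed

text \<open>\<open>G\<close> is an inner product and \<open>d u v w\<close> stands for its derivative \<open>D\<^sub>u G(v, w)\<close>.  Permuting the
  arguments in the compatibility condition gives the Koszul formula
  \<open>2 G(B u v, w) = d u v w + d v u w - d w u v\<close>, which determines \<open>B\<close>.\<close>

lemma koszul:
  fixes G :: "'e::euclidean_space \<Rightarrow> 'e \<Rightarrow> real" and d :: "'e \<Rightarrow> 'e \<Rightarrow> 'e \<Rightarrow> real"
  assumes G: "bilinear G" and sym: "\<And>u v. G u v = G v u" and pos: "\<And>u. u \<noteq> 0 \<Longrightarrow> G u u > 0"
    and d1: "\<And>v w. linear (\<lambda>u. d u v w)" and d2: "\<And>u w. linear (\<lambda>v. d u v w)"
    and dsym: "\<And>u v w. d u v w = d u w v"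
  shows "\<exists>!B. bilinear B \<and> (\<forall>u v. B u v = B v u) \<and> (\<forall>u v w. d u v w = G (B u v) w + G v (B u w))"
proof -
  have d3: "linear (\<lambda>w. d u v w)" for u v using d2 [of u v] by (subst dsym) simp
  have lin2: "linear (G u)" and lin1: "linear (\<lambda>u. G u w)" for u w
    using G unfolding bilinear_def by auto
  have cancel: "b = b'" if "\<And>w. G b w = G b' w" for b b'
  proof (rule ccontr)
    assume "b \<noteq> b'"
    then have "G (b - b') (b - b') > 0" using pos by simp
    then show False using that [of "b - b'"] linear_diff [OF lin1, of b b' "b - b'"] by simp
  qed
  let ?L = "\<lambda>u v w. (d u v w + d v u w - d w u v) / 2"
  have "linear (?L u v)" for u v
  proof -
    have "linear (\<lambda>w. (1/2) *\<^sub>R (d u v w + d v u w - d w u v))"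
      by (intro linear_compose_scale_right linear_compose_sub linear_compose_add d3 d1)
    then show ?thesis by simp
  qed
  then have "\<exists>b. \<forall>w. G b w = ?L u v w" for u v
    using riesz_representation [OF G pos, of "?L u v"] by metis
  then obtain B where B: "\<And>u v w. G (B u v) w = ?L u v w" by metis
  have Bsym: "B u v = B v u" for u v
    by (rule cancel) (simp add: B dsym [of _ v u])
  have Blin: "linear (\<lambda>u. B u v)" for v
    by (rule linearI; rule cancel)
      (simp_all add: B linear_add [OF lin1] linear_cmul [OF lin1] linear_add [OF d1] linear_add [OF d2]
        linear_cmul [OF d1] linear_cmul [OF d2] add_divide_distrib diff_divide_distrib right_diff_distrib distrib_left)
  have "(\<lambda>v. B v u) = B u" for u using Bsym by blast
  then have "bilinear B" using Blin unfolding bilinear_def by metis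
  moreover have "d u v w = G (B u v) w + G v (B u w)" for u v w
    unfolding sym [of v "B u w"] B by (simp add: dsym [of v w u] dsym [of w v u] dsym [of u w v] field_simps)
  ultimately have "bilinear B \<and> (\<forall>u v. B u v = B v u) \<and> (\<forall>u v w. d u v w = G (B u v) w + G v (B u w))"
    using Bsym by blast
  moreover have "C = B"
    if C: "bilinear C \<and> (\<forall>u v. C u v = C v u) \<and> (\<forall>u v w. d u v w = G (C u v) w + G v (C u w))" for C
  proof (intro ext cancel)
    fix u v w
    have "d u v w = G (C u v) w + G v (C u w)" "d v u w = G (C u v) w + G u (C v w)"
      "d w u v = G (C u w) v + G u (C v w)"
      using C by metis+
    then have "G (C u v) w = ?L u v w" using sym [of v "C u w"] by (simp add: field_simps)
    then show "G (C u v) w = G (B u v) w" by (simp only: B)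
  qed
  ultimately show ?thesis by (rule ex1I)
qed

lemma tangent_of:
  assumes "smooth_atlas A" "c \<in> A" "p \<in> cdom c"
  shows "tangent_of A c p u \<in> tangent_space A p" "tangent_of A c p u c = u"
proof -
  obtain v where "v \<in> tangent_space A p" "v c = u" using tangent_exists [OF assms] .
  then have "u \<in> (\<lambda>v. v c) ` tangent_space A p" by blast
  then show "tangent_of A c p u \<in> tangent_space A p" "tangent_of A c p u c = u"
    unfolding tangent_of_def by (rule inv_into_into, rule f_inv_into_f)
qed

lemma tangent_of_add:
  assumes "smooth_atlas A" "c \<in> A" "p \<in> cdom c"
  shows "tangent_of A c p (u + v) = tadd (tangent_of A c p u) (tangent_of A c p v)"
  using assms
  by (intro tangent_eqI [OF _ _ assms(2,3)] tadd_in_tangent_space) (simp_all add: tangent_of tadd_def)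

lemma tangent_of_scale:
  assumes "smooth_atlas A" "c \<in> A" "p \<in> cdom c"
  shows "tangent_of A c p (a *\<^sub>R u) = tscale a (tangent_of A c p u)"
  using assms
  by (intro tangent_eqI [OF _ _ assms(2,3)] tscale_in_tangent_space) (simp_all add: tangent_of tscale_def)

lemma metric_coord_inner_product:
  assumes A: "smooth_atlas A" and g: "riemannian_metric A g" and c: "c \<in> A" and y: "y \<in> cimg c"
  shows "bilinear (metric_coord A g c y)" "metric_coord A g c y u v = metric_coord A g c y v u"
    "u \<noteq> 0 \<Longrightarrow> metric_coord A g c y u u > 0"
proof -
  let ?p = "cinv c y" and ?G = "metric_coord A g c y"
  have p: "?p \<in> cdom c" using y by (rule cinv_in_cdom)
  then have car: "?p \<in> carrier A" using c by (auto simp: carrier_def)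
  note T = tangent_of(1) [OF A c p]
  have sym: "?G u v = ?G v u" for u v
    using g car T unfolding riemannian_metric_def metric_coord_def by blast
  show "?G u v = ?G v u" by (rule sym)
  have lin: "linear (\<lambda>u. ?G u v)" for v
  proof (rule linearI)
    show "?G (u + w) v = ?G u v + ?G w v" for u w
      using g car T unfolding riemannian_metric_def metric_coord_def tangent_of_add [OF A c p] by blast
    show "?G (a *\<^sub>R u) v = a *\<^sub>R ?G u v" for a u
      using g car T unfolding riemannian_metric_def metric_coord_def tangent_of_scale [OF A c p]
      by (simp only: real_scaleR_def)
  qed
  moreover have "(\<lambda>v. ?G v u) = ?G u" for u by (rule ext) (rule sym)
  then have "linear (?G u)" for u using lin [of u] by simp
  ultimately show "bilinear ?G" unfolding bilinear_def by blast
  assume "u \<noteq> 0"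
  then have "tangent_of A c ?p u \<noteq> tzero" using tangent_of(2) [OF A c p, of u] by (auto simp: tzero_def)
  then show "?G u u > 0"
    using g car T unfolding riemannian_metric_def metric_coord_def by blast
qed

text \<open>The Christoffel operator is a definite description, so its algebraic properties rest on the
  fundamental theorem of Riemannian geometry at a single point.\<close>

lemma levi_civita_at_christoffel:
  fixes A :: "('a, 'e::euclidean_space) chart set"
  assumes A: "smooth_atlas A" and g: "riemannian_metric A g" and c: "c \<in> A" and y: "y \<in> cimg c"
  shows "levi_civita_at A g c y (christoffel A g c y)"
proof -
  let ?G = "metric_coord A g c"
  let ?d = "\<lambda>u v w. frechet_derivative (\<lambda>z. ?G z v w) (at y) u"
  note ip = metric_coord_inner_product [OF A g c]
  have open_c: "open (cimg c)" using smooth_atlasD(2) [OF A c] .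
  have diff: "(\<lambda>z. ?G z v w) differentiable (at y)" for v w
    using g c y unfolding riemannian_metric_def by (blast intro: smooth_on_imp_differentiable)
  note hd = has_derivative_frechet_derivative [OF diff]
  have lin: "linear (\<lambda>u. ?G z u w)" if "z \<in> cimg c" for z w
    using ip(1) [OF that] unfolding bilinear_def by blast
  have sym: "?d u v w = ?d u w v" for u v w
    by (rule arg_cong [where f = "\<lambda>D. D u"], rule frechet_derivative_cong_open [OF open_c y]) (rule ip(2))
  have d2: "linear (\<lambda>v. ?d u v w)" for u w
  proof (rule linearI)
    fix v v' :: 'e and a :: real
    have "frechet_derivative (\<lambda>z. ?G z (v + v') w) (at y) = frechet_derivative (\<lambda>z. ?G z v w + ?G z v' w) (at y)"
      by (rule frechet_derivative_cong_open [OF open_c y]) (rule linear_add [OF lin])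
    also have "\<dots> = (\<lambda>u. ?d u v w + ?d u v' w)"
      by (rule frechet_derivative_eqI) (intro has_derivative_add hd)
    finally show "?d u (v + v') w = ?d u v w + ?d u v' w" by simp
    have "frechet_derivative (\<lambda>z. ?G z (a *\<^sub>R v) w) (at y) = frechet_derivative (\<lambda>z. a *\<^sub>R ?G z v w) (at y)"
      by (rule frechet_derivative_cong_open [OF open_c y]) (rule linear_cmul [OF lin])
    also have "\<dots> = (\<lambda>u. a *\<^sub>R ?d u v w)"
      by (rule frechet_derivative_eqI) (intro has_derivative_scaleR_right hd)
    finally show "?d u (a *\<^sub>R v) w = a *\<^sub>R ?d u v w" by simp
  qed
  have "\<exists>!B. levi_civita_at A g c y B"
    unfolding levi_civita_at_def
    by (rule koszul [where d = ?d, OF ip(1) [OF y] ip(2) [OF y] ip(3) [OF y]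
          linear_frechet_derivative [OF diff] d2 sym])
  then show ?thesis unfolding christoffel_def by (rule theI')
qed

lemma christoffel_bilinear:
  assumes "riemannian_manifold A g" "c \<in> A" "y \<in> cimg c"
  shows "bilinear (christoffel A g c y)" "christoffel A g c y u v = christoffel A g c y v u"
proof -
  have "levi_civita_at A g c y (christoffel A g c y)"
    using levi_civita_at_christoffel assms
    unfolding riemannian_manifold_def smooth_manifold_def by blast
  then show "bilinear (christoffel A g c y)" "christoffel A g c y u v = christoffel A g c y v u"
    unfolding levi_civita_at_def by blast+
qed


section \<open>The fields and their brackets in coordinates\<close>

text \<open>Along a line in the fibre over a point the coordinate fields are quadratic polynomials in the
  parameter, so their derivatives in fibre directions are read off as linear coefficients.\<close>

lemma frechet_derivative_from_quadratic:
  assumes "F differentiable (at z)" "\<And>s. F (z + s *\<^sub>R w) = a + s *\<^sub>R b + s\<^sup>2 *\<^sub>R e"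
  shows "frechet_derivative F (at z) w = b"
proof -
  have "((\<lambda>s. a + s *\<^sub>R b + s\<^sup>2 *\<^sub>R e) has_vector_derivative b) (at 0)"
    by (auto intro!: derivative_eq_intros)
  then have "((\<lambda>s. F (z + s *\<^sub>R w)) has_vector_derivative b) (at 0)" by (simp add: assms(2))
  then show ?thesis
    using frechet_derivative_along_line [of F z 0 w] assms(1) vector_derivative_unique_at by auto
qed

lemma sum_velocity_components:
  assumes A: "smooth_atlas A" and \<gamma>: "integral_curve (sum_atlas A) f J (\<lambda>t. (x t, V t, R t))"
    and t: "t \<in> J" and c: "c \<in> A" "x t \<in> cdom c"
  shows "((cmap c \<circ> x) has_vector_derivative fst (f (x t, V t, R t) (sum_chart A c))) (at t)"
    "((\<lambda>s. V s c) has_vector_derivative fst (snd (f (x t, V t, R t) (sum_chart A c)))) (at t)"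
    "((\<lambda>s. R s c) has_vector_derivative snd (snd (f (x t, V t, R t) (sum_chart A c)))) (at t)"
  using \<gamma> t c sum_velocity_iff [OF A _ t]
  unfolding integral_curve_def has_velocity_def [of "sum_atlas A"] by blast+

text \<open>A field specified through its integral curves is determined at a point by one integral curve
  through that point, which exists because the field is smooth.\<close>

lemma field_1_in_chart:
  assumes A: "smooth_atlas A" and f: "is_field_1 A g f"
    and p: "(x, V, R) \<in> carrier (sum_atlas A)" and c: "c \<in> A" "x \<in> cdom c"
  defines "\<Gamma> \<equiv> christoffel A g c (cmap c x)"
  shows "f (x, V, R) (sum_chart A c) = (V c, R c - \<Gamma> (V c) (V c), - V c - \<Gamma> (V c) (R c))"
proof -
  have "vector_field (sum_atlas A) f" using f unfolding is_field_1_def by blast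
  then obtain J \<gamma> where \<gamma>: "integral_curve (sum_atlas A) f J \<gamma>" "0 \<in> J" "\<gamma> 0 = (x, V, R)"
    using integral_curve_exists [OF smooth_atlas_sum_atlas [OF A] _ p] by blast
  define x' V' R' where "x' = fst \<circ> \<gamma>" and "V' = fst \<circ> snd \<circ> \<gamma>" and "R' = snd \<circ> snd \<circ> \<gamma>"
  have eq: "\<gamma> = (\<lambda>t. (x' t, V' t, R' t))" by (auto simp: x'_def V'_def R'_def)
  have 0: "x' 0 = x" "V' 0 = V" "R' 0 = R" using \<gamma>(3) by (auto simp: x'_def V'_def R'_def)
  have int: "integral_curve (sum_atlas A) f J (\<lambda>t. (x' t, V' t, R' t))" using \<gamma>(1) eq by simp
  then have "\<forall>t\<in>J. has_velocity A x' t (V' t) \<and>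
      has_covariant_derivative A g x' R' t (tscale (-1) (V' t)) \<and>
      has_covariant_derivative A g x' V' t (R' t)"
    using f unfolding is_field_1_def by blast
  then have "has_velocity A x' 0 V" "has_covariant_derivative A g x' R' 0 (tscale (-1) V)"
    "has_covariant_derivative A g x' V' 0 R"
    using \<gamma>(2) 0 by auto
  then have d: "((cmap c \<circ> x') has_vector_derivative V c) (at 0)"
    "((\<lambda>s. V' s c) has_vector_derivative R c - christoffel A g c (cmap c x)
        (vector_derivative (cmap c \<circ> x') (at 0)) (V c)) (at 0)"
    "((\<lambda>s. R' s c) has_vector_derivative - V c - christoffel A g c (cmap c x)
        (vector_derivative (cmap c \<circ> x') (at 0)) (R c)) (at 0)"
    using c 0 unfolding has_velocity_def has_covariant_derivative_def tscale_def by auto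
  have "x' 0 \<in> cdom c" using c 0 by simp
  note e = sum_velocity_components [OF A int \<gamma>(2) c(1) this, unfolded 0]
  show ?thesis
    using vector_derivative_unique_at [OF e(1) d(1)] vector_derivative_unique_at [OF e(2) d(2)]
      vector_derivative_unique_at [OF e(3) d(3)]
    unfolding vector_derivative_at [OF d(1)] \<Gamma>_def by (simp add: prod_eq_iff)
qed

lemma field_2_in_chart:
  assumes A: "smooth_atlas A" and f: "is_field_2 A f"
    and p: "(x, V, R) \<in> carrier (sum_atlas A)" and c: "c \<in> A" "x \<in> cdom c"
  shows "f (x, V, R) (sum_chart A c) = (0, V c, R c)"
proof -
  have "vector_field (sum_atlas A) f" using f unfolding is_field_2_def by blast
  then obtain J \<gamma> where \<gamma>: "integral_curve (sum_atlas A) f J \<gamma>" "0 \<in> J" "\<gamma> 0 = (x, V, R)"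
    using integral_curve_exists [OF smooth_atlas_sum_atlas [OF A] _ p] by blast
  define x' V' R' where "x' = fst \<circ> \<gamma>" and "V' = fst \<circ> snd \<circ> \<gamma>" and "R' = snd \<circ> snd \<circ> \<gamma>"
  have eq: "\<gamma> = (\<lambda>t. (x' t, V' t, R' t))" by (auto simp: x'_def V'_def R'_def)
  have 0: "x' 0 = x" "V' 0 = V" "R' 0 = R" using \<gamma>(3) by (auto simp: x'_def V'_def R'_def)
  have int: "integral_curve (sum_atlas A) f J (\<lambda>t. (x' t, V' t, R' t))" using \<gamma>(1) eq by simp
  have x': "x' 0 \<in> cdom c" using c 0 by simp
  have "has_velocity A x' 0 tzero \<and> (\<forall>c\<in>A. x' 0 \<in> cdom c \<longrightarrow>
      ((\<lambda>s. R' s c) has_vector_derivative R' 0 c) (at 0) \<and>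
      ((\<lambda>s. V' s c) has_vector_derivative V' 0 c) (at 0))"
    using f int \<gamma>(2) unfolding is_field_2_def by blast
  then have d: "((cmap c \<circ> x') has_vector_derivative 0) (at 0)"
    "((\<lambda>s. V' s c) has_vector_derivative V c) (at 0)" "((\<lambda>s. R' s c) has_vector_derivative R c) (at 0)"
    using c x' 0 unfolding has_velocity_def tzero_def by auto
  note e = sum_velocity_components [OF A int \<gamma>(2) c(1) x', unfolded 0]
  show ?thesis
    using vector_derivative_unique_at [OF e(1) d(1)] vector_derivative_unique_at [OF e(2) d(2)]
      vector_derivative_unique_at [OF e(3) d(3)]
    by (simp add: prod_eq_iff)
qed

lemma field_in_sum_chart:
  assumes A: "smooth_atlas A" and c: "c \<in> A" and y: "y \<in> cimg c"
    and f: "\<And>x V R. (x, V, R) \<in> carrier (sum_atlas A) \<Longrightarrow> x \<in> cdom c \<Longrightarrow>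
      f (x, V, R) (sum_chart A c) = \<Phi> (cmap c x) (V c) (R c)"
  shows "field_in_chart (sum_chart A c) f (y, v, r) = \<Phi> y v r"
proof -
  let ?C = "sum_chart A c"
  have z: "(y, v, r) \<in> cimg ?C" using y by (simp add: cimg_sum_chart [OF A c])
  obtain x V R where p: "cinv ?C (y, v, r) = (x, V, R)" by (metis prod_cases3)
  have in_C: "(x, V, R) \<in> cdom ?C" using cinv_in_cdom [OF z] p by simp
  then have "(x, V, R) \<in> carrier (sum_atlas A)"
    using c unfolding carrier_sum_atlas cdom_sum_chart by (auto simp: carrier_def)
  moreover have "x \<in> cdom c" using in_C by (simp add: cdom_sum_chart)
  moreover have "(cmap c x, V c, R c) = (y, v, r)"
    using cmap_cinv [OF z] unfolding p cmap_sum_chart .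
  ultimately show ?thesis using f [of x V R] p by simp
qed

lemma sum_chart_of_point:
  assumes "(x, V, R) \<in> carrier (sum_atlas A)" "c \<in> A" "x \<in> cdom c"
  shows "(x, V, R) \<in> cdom (sum_chart A c)" "sum_chart A c \<in> sum_atlas A"
  using assms(1,3) unfolding carrier_sum_atlas cdom_sum_chart
  by (simp_all add: sum_atlas_def assms(2))

context
  fixes A :: "('a, 'e::euclidean_space) chart set" and g :: "('a, 'e) metric"
    and f1 f2 :: "('a, 'e) tpair \<Rightarrow> (('a, 'e) tpair, 'e \<times> 'e \<times> 'e) tangent"
  assumes M: "riemannian_manifold A g" and f1: "is_field_1 A g f1" and f2: "is_field_2 A f2"
begin

private lemma atlas: "smooth_atlas A"
  using M unfolding riemannian_manifold_def smooth_manifold_def by blast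

private lemma sum_atlas: "smooth_atlas (sum_atlas A)"
  using atlas by (rule smooth_atlas_sum_atlas)

private abbreviation (input) "f21 \<equiv> lie_bracket (sum_atlas A) f2 f1"
private abbreviation (input) "f121 \<equiv> lie_bracket (sum_atlas A) f1 f21"

private lemma
  assumes "c \<in> A" "y \<in> cimg c"
  shows \<Gamma>_sym: "christoffel A g c y u v = christoffel A g c y v u"
    and \<Gamma>_add1: "christoffel A g c y (u + w) v = christoffel A g c y u v + christoffel A g c y w v"
    and \<Gamma>_add2: "christoffel A g c y v (u + w) = christoffel A g c y v u + christoffel A g c y v w"
    and \<Gamma>_diff2: "christoffel A g c y v (u - w) = christoffel A g c y v u - christoffel A g c y v w"
    and \<Gamma>_scale1: "christoffel A g c y (a *\<^sub>R u) v = a *\<^sub>R christoffel A g c y u v"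
    and \<Gamma>_scale2: "christoffel A g c y v (a *\<^sub>R u) = a *\<^sub>R christoffel A g c y v u"
  using christoffel_bilinear [OF M assms]
  by (simp_all add: bilinear_ladd bilinear_radd bilinear_rsub bilinear_lmul bilinear_rmul)

private lemmas \<Gamma>_linear = \<Gamma>_add1 \<Gamma>_add2 \<Gamma>_diff2 \<Gamma>_scale1 \<Gamma>_scale2

private lemma f1_coord:
  assumes "c \<in> A" "y \<in> cimg c"
  shows "field_in_chart (sum_chart A c) f1 (y, v, r) =
    (v, r - christoffel A g c y v v, - v - christoffel A g c y v r)"
  by (rule field_in_sum_chart [OF atlas assms, where \<Phi> = "\<lambda>y v r.
    (v, r - christoffel A g c y v v, - v - christoffel A g c y v r)"])
    (rule field_1_in_chart [OF atlas f1 _ assms(1)])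

private lemma f2_coord:
  assumes "c \<in> A" "y \<in> cimg c"
  shows "field_in_chart (sum_chart A c) f2 (y, v, r) = (0, v, r)"
  by (rule field_in_sum_chart [OF atlas assms, where \<Phi> = "\<lambda>y v r. (0, v, r)"])
    (rule field_2_in_chart [OF atlas f2 _ assms(1)])

private lemma open_chart: "c \<in> A \<Longrightarrow> open (cimg c \<times> (UNIV :: ('e \<times> 'e) set))"
  using smooth_atlasD(2) [OF atlas] by (simp add: open_Times)

private lemma differentiable_fields: "differentiable_field (sum_atlas A) f1" "differentiable_field (sum_atlas A) f2"
  using f1 f2 unfolding is_field_1_def is_field_2_def by (blast intro: vector_field_imp_differentiable_field)+

private lemma differentiable_in_sum_chart:
  assumes "differentiable_field (sum_atlas A) f" "c \<in> A" "y \<in> cimg c"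
  shows "field_in_chart (sum_chart A c) f differentiable (at (y, v, r))"
  using assms unfolding differentiable_field_def sum_atlas_def by (simp add: cimg_sum_chart [OF atlas])

text \<open>In the fibre coordinates \<open>f1 = S + h\<close>, where \<open>S = (V, -\<Gamma>(V,V), -\<Gamma>(V,R))\<close> transports the pair
  along \<open>V\<close> and \<open>h = (0, R, -V)\<close> is vertical.  The dilation field \<open>f2\<close> commutes with \<open>h\<close>, which is
  linear in the fibre, and satisfies \<open>[f2, S] = S\<close> because the base component of \<open>S\<close> has degree one
  and its fibre components have degree two; so the bracket is \<open>S\<close>.\<close>

lemma f21_in_chart:
  assumes p: "(x, V, R) \<in> carrier (sum_atlas A)" and c: "c \<in> A" "x \<in> cdom c"
  defines "\<Gamma> \<equiv> christoffel A g c (cmap c x)"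
  shows "f21 (x, V, R) (sum_chart A c) = (V c, - \<Gamma> (V c) (V c), - \<Gamma> (V c) (R c))"
proof -
  let ?C = "sum_chart A c" and ?y = "cmap c x" and ?v = "V c" and ?r = "R c"
  let ?z = "(?y, ?v, ?r)"
  have y: "?y \<in> cimg c" using c(2) by (rule cmap_in_cimg)
  note lin = \<Gamma>_linear [OF c(1) y]
  have D1: "frechet_derivative (field_in_chart ?C f1) (at ?z) (0, ?v, ?r) =
      (?v, ?r - 2 *\<^sub>R \<Gamma> ?v ?v, - ?v - 2 *\<^sub>R \<Gamma> ?v ?r)"
  proof (rule frechet_derivative_from_quadratic
      [where a = "(?v, ?r - \<Gamma> ?v ?v, - ?v - \<Gamma> ?v ?r)" and e = "(0, - \<Gamma> ?v ?v, - \<Gamma> ?v ?r)"])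
    show "field_in_chart ?C f1 differentiable (at ?z)"
      by (rule differentiable_in_sum_chart [OF differentiable_fields(1) c(1) y])
    show "field_in_chart ?C f1 (?z + s *\<^sub>R (0, ?v, ?r)) = (?v, ?r - \<Gamma> ?v ?v, - ?v - \<Gamma> ?v ?r) +
        s *\<^sub>R (?v, ?r - 2 *\<^sub>R \<Gamma> ?v ?v, - ?v - 2 *\<^sub>R \<Gamma> ?v ?r) + s\<^sup>2 *\<^sub>R (0, - \<Gamma> ?v ?v, - \<Gamma> ?v ?r)" for s
      using f1_coord [OF c(1) y, of "?v + s *\<^sub>R ?v" "?r + s *\<^sub>R ?r"] lin
      by (simp add: \<Gamma>_def algebra_simps power2_eq_square flip: scaleR_left_distrib)
  qed
  have "((\<lambda>z. (0, snd z)) has_derivative (\<lambda>z::'e \<times> 'e \<times> 'e. (0::'e, snd z))) (at ?z)"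
    by (auto intro!: derivative_eq_intros)
  then have "(field_in_chart ?C f2 has_derivative (\<lambda>z. (0, snd z))) (at ?z)"
    by (rule has_derivative_transform_within_open [OF _ open_chart [OF c(1)]])
      (use y in \<open>auto simp: f2_coord [OF c(1)]\<close>)
  then have D2: "frechet_derivative (field_in_chart ?C f2) (at ?z) = (\<lambda>z. (0, snd z))"
    by (rule frechet_derivative_eqI)
  show ?thesis
    using lie_bracket_in_chart(2) [OF sum_atlas differentiable_fields(2,1) p]
      sum_chart_of_point [OF p c]
      field_1_in_chart [OF atlas f1 p c] field_2_in_chart [OF atlas f2 p c]
    by (simp add: bracket_in_chart_def cmap_sum_chart D1 D2 \<Gamma>_def scaleR_2)
qed

private lemma f21_coord:
  assumes "c \<in> A" "y \<in> cimg c"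
  shows "field_in_chart (sum_chart A c) f21 (y, v, r) =
    (v, - christoffel A g c y v v, - christoffel A g c y v r)"
  by (rule field_in_sum_chart [OF atlas assms, where \<Phi> = "\<lambda>y v r.
    (v, - christoffel A g c y v v, - christoffel A g c y v r)"])
    (rule f21_in_chart [OF _ assms(1)])

text \<open>In a chart \<open>f21\<close> differs from the smooth field \<open>f1\<close> by a linear map.  This gives the regularity
  needed for a second bracket and for uniqueness of integral curves.\<close>

lemma f21_C1:
  assumes C: "C \<in> sum_atlas A"
  shows "Ck_on 1 (field_in_chart C f21) (cimg C)"
proof -
  obtain c where c: "c \<in> A" "C = sum_chart A c" using C unfolding sum_atlas_def by blast
  have o: "open (cimg C)" using smooth_atlasD(2) [OF sum_atlas C] .
  have "vector_field (sum_atlas A) f1" using f1 unfolding is_field_1_def by blast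
  then have "Ck_on 1 (field_in_chart C f1) (cimg C)"
    using C unfolding vector_field_def smooth_on_def by blast
  moreover have "Ck_on 1 (\<lambda>z::'e \<times> 'e \<times> 'e. (0::'e, - snd (snd z), fst (snd z))) (cimg C)"
    by (intro Ck_on_linear linear_conv_bounded_linear [THEN iffD1] linearI) simp_all
  ultimately have "Ck_on 1 (\<lambda>z. field_in_chart C f1 z + (0, - snd (snd z), fst (snd z))) (cimg C)"
    by (rule Ck_on_add [OF o])
  then show ?thesis
    by (rule Ck_on_cong [OF o, rotated])
      (auto simp: c(2) cimg_sum_chart [OF atlas c(1)] f1_coord [OF c(1)] f21_coord [OF c(1)])
qed

lemma f21_tangent:
  "p \<in> carrier (sum_atlas A) \<Longrightarrow> f21 p \<in> tangent_space (sum_atlas A) p"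
  by (rule lie_bracket_in_chart(1) [OF sum_atlas differentiable_fields(2,1)])

private lemma f21_differentiable: "differentiable_field (sum_atlas A) f21"
  using f21_C1 f21_tangent unfolding differentiable_field_def by simp

lemma f121_tangent:
  "p \<in> carrier (sum_atlas A) \<Longrightarrow> f121 p \<in> tangent_space (sum_atlas A) p"
  by (rule lie_bracket_in_chart(1) [OF sum_atlas differentiable_fields(1) f21_differentiable])

text \<open>Since \<open>f1 = f21 + h\<close> with \<open>h = (0, R, -V)\<close>, the bracket is \<open>[h, f21]\<close>.  The field \<open>h\<close> rotates the
  pair \<open>(V, R)\<close> infinitesimally, so that the transport of the pair along \<open>V\<close> becomes its transport
  along \<open>R\<close>.\<close>

lemma f121_in_chart:
  assumes p: "(x, V, R) \<in> carrier (sum_atlas A)" and c: "c \<in> A" "x \<in> cdom c"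
  defines "\<Gamma> \<equiv> christoffel A g c (cmap c x)"
  shows "f121 (x, V, R) (sum_chart A c) = (R c, - \<Gamma> (R c) (V c), - \<Gamma> (R c) (R c))"
proof -
  let ?C = "sum_chart A c" and ?y = "cmap c x" and ?v = "V c" and ?r = "R c"
  let ?z = "(?y, ?v, ?r)" and ?h = "\<lambda>z::'e \<times> 'e \<times> 'e. (0::'e, snd (snd z), - fst (snd z))"
  let ?D = "frechet_derivative (field_in_chart ?C f21) (at ?z)"
  have y: "?y \<in> cimg c" using c(2) by (rule cmap_in_cimg)
  note lin = \<Gamma>_linear [OF c(1) y]
  have diff: "field_in_chart ?C f21 differentiable (at ?z)"
    by (rule differentiable_in_sum_chart [OF f21_differentiable c(1) y])
  have D21: "?D (?h ?z) = (?r, - 2 *\<^sub>R \<Gamma> ?v ?r, \<Gamma> ?v ?v - \<Gamma> ?r ?r)"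
  proof (rule frechet_derivative_from_quadratic [OF diff,
      where a = "(?v, - \<Gamma> ?v ?v, - \<Gamma> ?v ?r)" and e = "(0, - \<Gamma> ?r ?r, \<Gamma> ?r ?v)"])
    show "field_in_chart ?C f21 (?z + s *\<^sub>R ?h ?z) = (?v, - \<Gamma> ?v ?v, - \<Gamma> ?v ?r) +
        s *\<^sub>R (?r, - 2 *\<^sub>R \<Gamma> ?v ?r, \<Gamma> ?v ?v - \<Gamma> ?r ?r) + s\<^sup>2 *\<^sub>R (0, - \<Gamma> ?r ?r, \<Gamma> ?r ?v)" for s
      using f21_coord [OF c(1) y, of "?v + s *\<^sub>R ?r" "?r - s *\<^sub>R ?v"] lin \<Gamma>_sym [OF c(1) y, of ?r ?v]
      by (simp add: \<Gamma>_def algebra_simps power2_eq_square scaleR_2)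
  qed
  have "((\<lambda>z. field_in_chart ?C f21 z + ?h z) has_derivative (\<lambda>w. ?D w + ?h w)) (at ?z)"
    by (intro has_derivative_add has_derivative_frechet_derivative [OF diff])
      (auto intro!: derivative_eq_intros)
  then have "(field_in_chart ?C f1 has_derivative (\<lambda>w. ?D w + ?h w)) (at ?z)"
    by (rule has_derivative_transform_within_open [OF _ open_chart [OF c(1)]])
      (use y in \<open>auto simp: f1_coord [OF c(1)] f21_coord [OF c(1)]\<close>)
  then have D1: "frechet_derivative (field_in_chart ?C f1) (at ?z) = (\<lambda>w. ?D w + ?h w)"
    by (rule frechet_derivative_eqI)
  have split: "f1 (x, V, R) ?C = f21 (x, V, R) ?C + ?h ?z"
    by (simp add: field_1_in_chart [OF atlas f1 p c] f21_in_chart [OF p c])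
  have "f121 (x, V, R) ?C = ?D (f1 (x, V, R) ?C) - (?D (f21 (x, V, R) ?C) + ?h (f21 (x, V, R) ?C))"
    using lie_bracket_in_chart(2) [OF sum_atlas differentiable_fields(1) f21_differentiable p
        sum_chart_of_point(2,1) [OF p c]]
    by (simp only: bracket_in_chart_def cmap_sum_chart D1)
  also have "\<dots> = ?D (?h ?z) - ?h (f21 (x, V, R) ?C)"
    unfolding split linear_add [OF linear_frechet_derivative [OF diff]] by (simp only: add_diff_cancel_left)
  also have "\<dots> = (?r, - \<Gamma> ?r ?v, - \<Gamma> ?r ?r)"
    unfolding D21 using \<Gamma>_sym [OF c(1) y, of ?r ?v] by (simp add: f21_in_chart [OF p c] \<Gamma>_def scaleR_2)
  finally show ?thesis .
qed

section \<open>Geodesics as projected integral curves\<close>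

private lemma integral_curve_f21_iff:
  "integral_curve (sum_atlas A) f21 J (\<lambda>t. (x t, V t, R t)) \<longleftrightarrow>
    curve_on (sum_atlas A) J (\<lambda>t. (x t, V t, R t)) \<and>
    (\<forall>t\<in>J. \<forall>c\<in>A. x t \<in> cdom c \<longrightarrow>
      ((cmap c \<circ> x) has_vector_derivative V t c) (at t) \<and>
      ((\<lambda>s. V s c) has_vector_derivative - christoffel A g c (cmap c (x t)) (V t c) (V t c)) (at t) \<and>
      ((\<lambda>s. R s c) has_vector_derivative - christoffel A g c (cmap c (x t)) (V t c) (R t c)) (at t))"
proof -
  have "has_velocity (sum_atlas A) (\<lambda>t. (x t, V t, R t)) t (f21 (x t, V t, R t)) \<longleftrightarrow>
      (\<forall>c\<in>A. x t \<in> cdom c \<longrightarrow>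
      ((cmap c \<circ> x) has_vector_derivative V t c) (at t) \<and>
      ((\<lambda>s. V s c) has_vector_derivative - christoffel A g c (cmap c (x t)) (V t c) (V t c)) (at t) \<and>
      ((\<lambda>s. R s c) has_vector_derivative - christoffel A g c (cmap c (x t)) (V t c) (R t c)) (at t))"
    if \<gamma>: "curve_on (sum_atlas A) J (\<lambda>t. (x t, V t, R t))" and t: "t \<in> J" for t
  proof -
    have car: "(x t, V t, R t) \<in> carrier (sum_atlas A)" by (rule curve_on_carrier [OF sum_atlas \<gamma> t])
    show ?thesis
      unfolding sum_velocity_iff [OF atlas \<gamma> t f21_tangent [OF car]]
      by (intro ball_cong imp_cong refl) (simp add: f21_in_chart [OF car])
  qed
  then show ?thesis unfolding integral_curve_def by blast
qed

private lemma integral_curve_f121_iff: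
  "integral_curve (sum_atlas A) f121 J (\<lambda>t. (x t, V t, R t)) \<longleftrightarrow>
    curve_on (sum_atlas A) J (\<lambda>t. (x t, V t, R t)) \<and>
    (\<forall>t\<in>J. \<forall>c\<in>A. x t \<in> cdom c \<longrightarrow>
      ((cmap c \<circ> x) has_vector_derivative R t c) (at t) \<and>
      ((\<lambda>s. V s c) has_vector_derivative - christoffel A g c (cmap c (x t)) (R t c) (V t c)) (at t) \<and>
      ((\<lambda>s. R s c) has_vector_derivative - christoffel A g c (cmap c (x t)) (R t c) (R t c)) (at t))"
proof -
  have "has_velocity (sum_atlas A) (\<lambda>t. (x t, V t, R t)) t (f121 (x t, V t, R t)) \<longleftrightarrow>
      (\<forall>c\<in>A. x t \<in> cdom c \<longrightarrow>
      ((cmap c \<circ> x) has_vector_derivative R t c) (at t) \<and>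
      ((\<lambda>s. V s c) has_vector_derivative - christoffel A g c (cmap c (x t)) (R t c) (V t c)) (at t) \<and>
      ((\<lambda>s. R s c) has_vector_derivative - christoffel A g c (cmap c (x t)) (R t c) (R t c)) (at t))"
    if \<gamma>: "curve_on (sum_atlas A) J (\<lambda>t. (x t, V t, R t))" and t: "t \<in> J" for t
  proof -
    have car: "(x t, V t, R t) \<in> carrier (sum_atlas A)" by (rule curve_on_carrier [OF sum_atlas \<gamma> t])
    show ?thesis
      unfolding sum_velocity_iff [OF atlas \<gamma> t f121_tangent [OF car]]
      by (intro ball_cong imp_cong refl) (simp add: f121_in_chart [OF car])
  qed
  then show ?thesis unfolding integral_curve_def by blast
qed

private lemma swap_curve_on:
  assumes "curve_on (sum_atlas A) J (\<lambda>t. (x t, V t, R t))"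
  shows "curve_on (sum_atlas A) J (\<lambda>t. (x t, R t, V t))"
  using sum_curve_onD [OF atlas assms] assms unfolding curve_on_def [of "sum_atlas A"]
  by (intro sum_curve_on [OF atlas, unfolded curve_on_def [of "sum_atlas A"]]) auto

text \<open>Exchanging \<open>V\<close> and \<open>R\<close> carries the integral curves of \<open>f21\<close> to those of \<open>f121\<close>.\<close>

private lemma flow_reaches_swap:
  "flow_reaches (sum_atlas A) f121 t (x, V, R) (x', V', R') \<longleftrightarrow>
   flow_reaches (sum_atlas A) f21 t (x, R, V) (x', R', V')"
proof -
  have swap: "integral_curve (sum_atlas A) f121 J (\<lambda>t. (x t, V t, R t)) \<longleftrightarrow>
      integral_curve (sum_atlas A) f21 J (\<lambda>t. (x t, R t, V t))" for J and x :: "real \<Rightarrow> 'a" and V R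
    unfolding integral_curve_f21_iff integral_curve_f121_iff using swap_curve_on by blast
  have reaches: "flow_reaches (sum_atlas A) f t (x, V, R) (x', V', R') \<longleftrightarrow>
    (\<exists>J X W Z. integral_curve (sum_atlas A) f J (\<lambda>t. (X t, W t, Z t)) \<and> 0 \<in> J \<and> t \<in> J \<and>
      X 0 = x \<and> W 0 = V \<and> Z 0 = R \<and> X t = x' \<and> W t = V' \<and> Z t = R')" for f x V R x' V' R'
  proof
    assume "flow_reaches (sum_atlas A) f t (x, V, R) (x', V', R')"
    then obtain J \<gamma> where \<gamma>: "integral_curve (sum_atlas A) f J \<gamma>" "0 \<in> J" "t \<in> J"
      "\<gamma> 0 = (x, V, R)" "\<gamma> t = (x', V', R')"
      unfolding flow_reaches_def by blast
    then show "\<exists>J X W Z. integral_curve (sum_atlas A) f J (\<lambda>t. (X t, W t, Z t)) \<and> 0 \<in> J \<and> t \<in> J \<and>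
      X 0 = x \<and> W 0 = V \<and> Z 0 = R \<and> X t = x' \<and> W t = V' \<and> Z t = R'"
      by (intro exI [of _ J] exI [of _ "\<lambda>t. fst (\<gamma> t)"] exI [of _ "\<lambda>t. fst (snd (\<gamma> t))"]
          exI [of _ "\<lambda>t. snd (snd (\<gamma> t))"]) simp
  qed (auto simp: flow_reaches_def)
  show ?thesis unfolding reaches swap by blast
qed

private lemma flow_f21_unique:
  assumes "flow_reaches (sum_atlas A) f21 t p q" "flow_reaches (sum_atlas A) f21 t p q'"
  shows "q = q'"
proof -
  have H: "Hausdorff_space (mfd_topology (sum_atlas A))"
    using M unfolding riemannian_manifold_def smooth_manifold_def
    by (blast intro: Hausdorff_sum_atlas)
  obtain J \<gamma> J' \<gamma>' where
    "integral_curve (sum_atlas A) f21 J \<gamma>" "0 \<in> J" "t \<in> J" "\<gamma> 0 = p" "\<gamma> t = q"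
    "integral_curve (sum_atlas A) f21 J' \<gamma>'" "0 \<in> J'" "t \<in> J'" "\<gamma>' 0 = p" "\<gamma>' t = q'"
    using assms unfolding flow_reaches_def by metis
  then show ?thesis
    using integral_curve_unique [OF sum_atlas H f21_C1, of J \<gamma> 0 J' \<gamma>' t] by simp
qed

private lemma flow_f21_eq:
  "flow_reaches (sum_atlas A) f21 t p q \<Longrightarrow> flow (sum_atlas A) f21 t p = q"
  unfolding flow_def by (blast intro: flow_f21_unique)

private lemma flow_f121_eq:
  assumes "flow_reaches (sum_atlas A) f121 t p q"
  shows "flow (sum_atlas A) f121 t p = q"
  unfolding flow_def
proof (rule the_equality, rule assms)
  fix q' assume q': "flow_reaches (sum_atlas A) f121 t p q'"
  obtain x V R x1 V1 R1 x2 V2 R2 where eq: "p = (x, V, R)" "q = (x1, V1, R1)" "q' = (x2, V2, R2)"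
    by (metis prod_cases3)
  show "q' = q"
    using flow_f21_unique [of t "(x, R, V)" "(x1, R1, V1)" "(x2, R2, V2)"] assms q'
    unfolding eq flow_reaches_swap by simp
qed

text \<open>The third component is not constrained by the geodesic equation; \<open>R = W\<close> is parallel along a
  geodesic with velocity \<open>W\<close>.\<close>

private lemma geodesic_lift:
  assumes \<gamma>: "curve_on A J \<gamma>"
    and W: "\<And>t. t \<in> J \<Longrightarrow> has_velocity A \<gamma> t (W t) \<and> has_covariant_derivative A g \<gamma> W t tzero"
  shows "integral_curve (sum_atlas A) f21 J (\<lambda>t. (\<gamma> t, W t, W t))"
proof -
  have d: "((cmap c \<circ> \<gamma>) has_vector_derivative W t c) (at t)"
    "((\<lambda>s. W s c) has_vector_derivative - christoffel A g c (cmap c (\<gamma> t)) (W t c) (W t c)) (at t)"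
    if "t \<in> J" "c \<in> A" "\<gamma> t \<in> cdom c" for t c
  proof -
    show d: "((cmap c \<circ> \<gamma>) has_vector_derivative W t c) (at t)"
      using W [OF that(1)] that(2,3) unfolding has_velocity_def by blast
    show "((\<lambda>s. W s c) has_vector_derivative - christoffel A g c (cmap c (\<gamma> t)) (W t c) (W t c)) (at t)"
      using W [OF that(1)] that(2,3) vector_derivative_at [OF d]
      unfolding has_covariant_derivative_def tzero_def by auto
  qed
  have "curve_on (sum_atlas A) J (\<lambda>t. (\<gamma> t, W t, W t))"
  proof (rule sum_curve_on [OF atlas _ _ _ \<gamma>])
    show "W t \<in> tangent_space A (\<gamma> t) \<and> W t \<in> tangent_space A (\<gamma> t)" if "t \<in> J" for t
      using W [OF that] unfolding has_velocity_def by blast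
    show "isCont (\<lambda>s. W s c) t \<and> isCont (\<lambda>s. W s c) t" if "t \<in> J" "c \<in> A" "\<gamma> t \<in> cdom c" for t c
      using has_vector_derivative_continuous [OF d(2) [OF that]] by blast
  qed (use \<gamma> in \<open>auto simp: curve_on_def\<close>)
  then show ?thesis unfolding integral_curve_f21_iff using d by blast
qed

private lemma geodesic_of_integral_curve:
  assumes "integral_curve (sum_atlas A) f21 J (\<lambda>t. (x t, V t, R t))"
  shows "geodesic A g J x" "t \<in> J \<Longrightarrow> has_velocity A x t (V t)"
proof -
  have c: "curve_on (sum_atlas A) J (\<lambda>t. (x t, V t, R t))"
    and d: "\<And>t c. t \<in> J \<Longrightarrow> c \<in> A \<Longrightarrow> x t \<in> cdom c \<Longrightarrow>
      ((cmap c \<circ> x) has_vector_derivative V t c) (at t) \<and>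
      ((\<lambda>s. V s c) has_vector_derivative - christoffel A g c (cmap c (x t)) (V t c) (V t c)) (at t)"
    using assms unfolding integral_curve_f21_iff by blast+
  note D = sum_curve_onD [OF atlas c]
  show vel: "has_velocity A x t (V t)" if "t \<in> J" for t
    using D(2) [OF that] d [OF that] unfolding has_velocity_def by blast
  have "has_covariant_derivative A g x V t tzero" if "t \<in> J" for t
    unfolding has_covariant_derivative_def
  proof (intro conjI ballI impI tzero_in_tangent_space [OF atlas])
    fix c assume c: "c \<in> A" "x t \<in> cdom c"
    then have "vector_derivative (cmap c \<circ> x) (at t) = V t c"
      using d [OF that] by (blast intro: vector_derivative_at)
    then show "((\<lambda>s. V s c) has_vector_derivative tzero c -
        christoffel A g c (cmap c (x t)) (vector_derivative (cmap c \<circ> x) (at t)) (V t c)) (at t)"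
      using d [OF that c] by (simp add: tzero_def)
  qed
  then show "geodesic A g J x" unfolding geodesic_def using D(1) vel by blast
qed

private lemma exp_reaches_unique:
  assumes "x \<in> carrier A" "exp_reaches A g x w y" "exp_reaches A g x w y'"
  shows "y = y'"
proof -
  have "\<exists>W. flow_reaches (sum_atlas A) f21 1 (x, w, w) (y, W, W)" if reach: "exp_reaches A g x w y" for y
  proof -
    obtain J \<gamma> where \<gamma>: "geodesic A g J \<gamma>" "0 \<in> J" "1 \<in> J" "\<gamma> 0 = x" "has_velocity A \<gamma> 0 w" "\<gamma> 1 = y"
      using reach unfolding exp_reaches_def by blast
    then obtain W where c: "curve_on A J \<gamma>"
      and W: "\<And>t. t \<in> J \<Longrightarrow> has_velocity A \<gamma> t (W t) \<and> has_covariant_derivative A g \<gamma> W t tzero"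
      unfolding geodesic_def by blast
    have "W 0 = w"
      using has_velocity_unique [of A \<gamma> 0 "W 0" w] W [OF \<gamma>(2)] \<gamma>(4,5) assms(1) by simp
    then show ?thesis
      using geodesic_lift [OF c W] \<gamma> unfolding flow_reaches_def
      by (intro exI [of _ "W 1"] exI [of _ J] exI [of _ "\<lambda>t. (\<gamma> t, W t, W t)"]) simp
  qed
  then show ?thesis using assms(2,3) flow_f21_unique by blast
qed

text \<open>Reparametrising \<open>s \<mapsto> ts\<close> turns time \<open>t\<close> with initial velocity \<open>V\<close> into time \<open>1\<close> with initial
  velocity \<open>tV\<close>; for \<open>t = 0\<close> this yields the constant geodesic on the whole line.\<close>

private lemma integral_curve_rescale:
  assumes "integral_curve (sum_atlas A) f21 J (\<lambda>t. (x t, V t, R t))"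
  shows "integral_curve (sum_atlas A) f21 ((\<lambda>s. a * s) -` J)
    (\<lambda>s. (x (a * s), tscale a (V (a * s)), R (a * s)))"
proof -
  let ?J = "(\<lambda>s. a * s) -` J"
  have c: "curve_on (sum_atlas A) J (\<lambda>t. (x t, V t, R t))"
    and d: "\<And>t c. t \<in> J \<Longrightarrow> c \<in> A \<Longrightarrow> x t \<in> cdom c \<Longrightarrow>
      ((cmap c \<circ> x) has_vector_derivative V t c) (at t) \<and>
      ((\<lambda>s. V s c) has_vector_derivative - christoffel A g c (cmap c (x t)) (V t c) (V t c)) (at t) \<and>
      ((\<lambda>s. R s c) has_vector_derivative - christoffel A g c (cmap c (x t)) (V t c) (R t c)) (at t)"
    using assms unfolding integral_curve_f21_iff by blast+
  note D = sum_curve_onD [OF atlas c]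
  have J: "open J" "is_interval J" using c unfolding curve_on_def by auto
  have J': "open ?J" "is_interval ?J"
  proof -
    show "open ?J" using J(1) by (intro open_vimage continuous_intros)
    have "linear (\<lambda>s::real. a * s)" by (rule linearI) (simp_all add: algebra_simps)
    then show "is_interval ?J"
      using J(2) unfolding is_interval_convex_1 by (rule convex_linear_vimage)
  qed
  have chain: "((\<lambda>s. f (a * s)) has_vector_derivative a *\<^sub>R f') (at s)"
    if "(f has_vector_derivative f') (at (a * s))" for f :: "real \<Rightarrow> 'e" and f' s
  proof -
    have "((\<lambda>s. a * s) has_vector_derivative a) (at s)"
      unfolding has_real_derivative_iff_has_vector_derivative [symmetric]
      by (auto intro!: derivative_eq_intros)
    from vector_diff_chain_at [OF this that] show ?thesis by (simp add: o_def)
  qed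
  have d': "((cmap c \<circ> (\<lambda>s. x (a * s))) has_vector_derivative tscale a (V (a * s)) c) (at s) \<and>
      ((\<lambda>s. tscale a (V (a * s)) c) has_vector_derivative
        - christoffel A g c (cmap c (x (a * s))) (tscale a (V (a * s)) c) (tscale a (V (a * s)) c)) (at s) \<and>
      ((\<lambda>s. R (a * s) c) has_vector_derivative
        - christoffel A g c (cmap c (x (a * s))) (tscale a (V (a * s)) c) (R (a * s) c)) (at s)"
    if "s \<in> ?J" "c \<in> A" "x (a * s) \<in> cdom c" for s c
  proof -
    have "a * s \<in> J" using that(1) by simp
    note d = d [OF this that(2,3)] and lin = \<Gamma>_linear [OF that(2) cmap_in_cimg [OF that(3)]]
    show ?thesis
      using chain [OF conjunct1 [OF d]] chain [OF conjunct2 [OF conjunct2 [OF d]]]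
        bounded_linear.has_vector_derivative [OF bounded_linear_scaleR_right
          chain [OF conjunct1 [OF conjunct2 [OF d]]], of a]
      by (simp add: o_def tscale_def lin)
  qed
  have "curve_on (sum_atlas A) ?J (\<lambda>s. (x (a * s), tscale a (V (a * s)), R (a * s)))"
  proof (rule sum_curve_on [OF atlas J'])
    have "continuous_map (top_of_set ?J) (top_of_set J) (\<lambda>s. a * s)"
      by (auto intro!: continuous_intros simp: continuous_map_in_subtopology)
    then have "continuous_map (top_of_set ?J) (mfd_topology A) (x \<circ> (\<lambda>s. a * s))"
      using D(1) unfolding curve_on_def by (blast intro: continuous_map_compose)
    then show "curve_on A ?J (\<lambda>s. x (a * s))" using J' unfolding curve_on_def by (simp add: o_def)
    show "tscale a (V (a * s)) \<in> tangent_space A (x (a * s)) \<and> R (a * s) \<in> tangent_space A (x (a * s))"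
      if "s \<in> ?J" for s
      using D(2) [of "a * s"] that tscale_in_tangent_space [OF atlas] by simp
    show "isCont (\<lambda>s. tscale a (V (a * s)) c) s \<and> isCont (\<lambda>s. R (a * s) c) s"
      if "s \<in> ?J" "c \<in> A" "x (a * s) \<in> cdom c" for s c
      using d' [OF that] by (blast intro: has_vector_derivative_continuous)
  qed
  then show ?thesis unfolding integral_curve_f21_iff using d' by blast
qed

private lemma exp_reaches_of_flow:
  assumes "flow_reaches (sum_atlas A) f21 t (x, V, R) q"
  shows "exp_reaches A g x (tscale t V) (bundle_proj q)"
proof -
  obtain J \<gamma> where \<gamma>: "integral_curve (sum_atlas A) f21 J \<gamma>" "0 \<in> J" "t \<in> J"
      "\<gamma> 0 = (x, V, R)" "\<gamma> t = q"
    using assms unfolding flow_reaches_def by blast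
  define x' V' R' where "x' = fst \<circ> \<gamma>" and "V' = fst \<circ> snd \<circ> \<gamma>" and "R' = snd \<circ> snd \<circ> \<gamma>"
  have "\<gamma> = (\<lambda>t. (x' t, V' t, R' t))" by (auto simp: x'_def V'_def R'_def)
  then have "integral_curve (sum_atlas A) f21 J (\<lambda>t. (x' t, V' t, R' t))" using \<gamma>(1) by simp
  note G = geodesic_of_integral_curve [OF integral_curve_rescale [OF this, of t]]
  have "x' 0 = x" "V' 0 = V" "x' t = bundle_proj q"
    using \<gamma>(4,5) by (auto simp: x'_def V'_def bundle_proj_def split: prod.splits)
  then show ?thesis
    using G(1) G(2) [of 0] \<gamma>(2,3) unfolding exp_reaches_def
    by (intro exI [of _ "(\<lambda>s. t * s) -` J"] exI [of _ "\<lambda>s. x' (t * s)"]) simp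
qed

lemma exp_of_flow_f21:
  assumes "(x, V, R) \<in> carrier (sum_atlas A)" "flow_reaches (sum_atlas A) f21 t (x, V, R) q"
  shows "tscale t V \<in> exp_domain A g x" "exp_map A g x (tscale t V) = bundle_proj q"
proof -
  have x: "x \<in> carrier A" using assms(1) by (simp add: carrier_sum_atlas)
  note r = exp_reaches_of_flow [OF assms(2)]
  show "tscale t V \<in> exp_domain A g x" unfolding exp_domain_def using r by blast
  show "exp_map A g x (tscale t V) = bundle_proj q"
    unfolding exp_map_def using r exp_reaches_unique [OF x] by blast
qed

lemma exp_of_flow:
  assumes p: "(x, V, R) \<in> carrier (sum_atlas A)"
  shows "flow_defined (sum_atlas A) f21 t (x, V, R) \<Longrightarrow>
      tscale t V \<in> exp_domain A g x \<and>
      bundle_proj (flow (sum_atlas A) f21 t (x, V, R)) = exp_map A g x (tscale t V)"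
    and "flow_defined (sum_atlas A) f121 t (x, V, R) \<Longrightarrow>
      tscale t R \<in> exp_domain A g x \<and>
      bundle_proj (flow (sum_atlas A) f121 t (x, V, R)) = exp_map A g x (tscale t R)"
proof -
  assume "flow_defined (sum_atlas A) f21 t (x, V, R)"
  then obtain q where q: "flow_reaches (sum_atlas A) f21 t (x, V, R) q"
    unfolding flow_defined_def by blast
  show "tscale t V \<in> exp_domain A g x \<and>
      bundle_proj (flow (sum_atlas A) f21 t (x, V, R)) = exp_map A g x (tscale t V)"
    using exp_of_flow_f21 [OF p q] flow_f21_eq [OF q] by simp
next
  assume "flow_defined (sum_atlas A) f121 t (x, V, R)"
  then obtain x' V' R' where q: "flow_reaches (sum_atlas A) f121 t (x, V, R) (x', V', R')"
    unfolding flow_defined_def by (metis prod_cases3)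
  then have q': "flow_reaches (sum_atlas A) f21 t (x, R, V) (x', R', V')"
    unfolding flow_reaches_swap .
  have "(x, R, V) \<in> carrier (sum_atlas A)" using p by (simp add: carrier_sum_atlas)
  then show "tscale t R \<in> exp_domain A g x \<and>
      bundle_proj (flow (sum_atlas A) f121 t (x, V, R)) = exp_map A g x (tscale t R)"
    using exp_of_flow_f21 [OF _ q'] flow_f121_eq [OF q] by (simp add: bundle_proj_def)
qed

end

theorem proposition4p1:
  fixes A :: "('a, 'e::euclidean_space) chart set"
    and g :: "('a, 'e) metric"
    and f1 f2 f21 f121 :: "('a, 'e) tpair \<Rightarrow> (('a, 'e) tpair, 'e \<times> 'e \<times> 'e) tangent"
  assumes "riemannian_manifold A g"
    and "DIM('e) > 1"
    and "is_field_1 A g f1"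
    and "is_field_2 A f2"
    and "f21 = lie_bracket (sum_atlas A) f2 f1"
    and "f121 = lie_bracket (sum_atlas A) f1 f21"
  shows "\<forall>(x, V, R) \<in> carrier (sum_atlas A). \<forall>t.
    (flow_defined (sum_atlas A) f21 t (x, V, R) \<longrightarrow>
       tscale t V \<in> exp_domain A g x \<and>
       bundle_proj (flow (sum_atlas A) f21 t (x, V, R)) = exp_map A g x (tscale t V)) \<and>
    (flow_defined (sum_atlas A) f121 t (x, V, R) \<longrightarrow>
       tscale t R \<in> exp_domain A g x \<and>
       bundle_proj (flow (sum_atlas A) f121 t (x, V, R)) = exp_map A g x (tscale t R))"
  unfolding assms(5,6) using exp_of_flow [OF assms(1,3,4)] by auto

end
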